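(* Let $w$ be a word of length $f\ge1$ in $\Gamma_n$, let $(P,Q)$ be its Berele $P$- and $Q$-symbols, $Q=(\kappa^{(0)},\dots,\kappa^{(f)})$, and let $P^{(f-1)}$ be the Berele $P$-symbol of the word obtained from $w$ by deleting the rightmost occurrence of the largest letter of $w$. Put $l=\max\{\ell(\kappa^{(j)}):0\le j\le f\}$, and let the largest letter of $P$ be $\gamma\in\{m,\bar m\}$ with $m\in[1,n]$. (1) If $m>l$, then $\gamma$ is the largest letter of $w$, and $P^{(f-1)}$ is obtained from $P$ by deleting the rightmost occurrence of $\gamma$. Assume from now on that $m\le l$. (2) If $P$ contains the letter $\bar l$, then $\bar l$ is the largest letter of $w$, and $P^{(f-1)}$ is obtained from $P$ by deleting the rightmost occurrence of $\bar l$. (3) If $P$ does not contain $\bar l$ and there is no $j$ with $\kappa^{(j-1)}\supset_l\kappa^{(j)}$, then $l$ is the largest letter of $w$ (and of $P$), and $P^{(f-1)}$ is obtained from $P$ by deleting the rightmost occurrence of $l$. Now suppose $P$ does not contain $\bar l$ and there is some $j$ with $\kappa^{(j-1)}\supset_l\kappa^{(j)}$. Let $\bar P$ be the tableau obtained from $P$ by adding a letter $l$ at the bottom of the leftmost column of $P$ that does not already contain $l$. Run the following backward test: set $\sigma_f=\mathrm{sh}(\bar P)$ and, for $j=f,f-1,\dots$, as long as $\sigma_j\supset\!\cdot\,\kappa^{(j)}$ and $j\ge1$, apply the local rules backwards to the cell with $\Lambda(B)=\sigma_j$, $\Lambda(C)=\kappa^{(j-1)}$, $\Lambda(D)=\kappa^{(j)}$,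 regarded as lying in the $\bar l$-stratum, and let $\sigma_{j-1}$ be the resulting $\Lambda(A)$. (4) If this test reaches the leftmost edge, i.e. it produces $\sigma_0$ with $\sigma_0\supset\!\cdot\,\kappa^{(0)}$, then $P^{(f-1)}\ne\bar P$; in this case $l$ is the largest letter of $w$ (and of $P$), and $P^{(f-1)}$ is obtained from $P$ by deleting the rightmost occurrence of $l$. (5) If the case $(\bigcirc)$ is encountered at some cell before reaching the leftmost edge, then $P^{(f-1)}=\bar P$, and the largest letter of $w$ is $\bar l$.
   Context: Partitions are identified with Young diagrams in matrix coordinates; $\ell(\lambda)$ is the number of nonzero parts. $\mu\subset_k\lambda$ (equivalently $\lambda\supset_k\mu$) means $\lambda$ is $\mu$ plus one cell in row $k$; $\mu\subset\!\cdot\,\lambda$ (equivalently $\lambda\supset\!\cdot\,\mu$) means $\mu\subset_k\lambda$ for some $k$. A domino is a skew shape of two cells adjacent in a row or a column. $\Gamma_n=\{1<\bar1<2<\bar2<\cdots<n<\bar n\}$. An $Sp(2n)$-tableau: entries in $\Gamma_n$, rows weakly increasing, columns strictly increasing, entries of row $i$ at least $i$. Row insertion: insert $x$ into row 1; the leftmost entry strictly larger than $x$ is replaced by $x$ and bumped into the next row similarly; if none, $x$ is appended. Jeu de taquin slide of a hole at $(i,j)$: if $(i+1,j)$ is in the shape and either $(i,j+1)$ is not or $T(i+1,j)\le T(i,j+1)$, move the entry of $(i+1,j)$ into the hole, otherwise the entry of $(i,j+1)$; repeat until the hole has no neighbour below or to the right, then delete it. Berele insertion $T\leftarrow_{\mathcal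 B}x$: row insert $x$; if the result is an $Sp(2n)$-tableau, done; otherwise at the earliest stage where a letter $\bar k$ in row $k$ is bumped by a letter $k$, erase this $k$ and $\bar k$, leave a hole at the former position of $\bar k$ and slide it out by jeu de taquin. Berele's correspondence: $P_i=(\cdots(\varnothing\leftarrow_{\mathcal B}w_1)\cdots)\leftarrow_{\mathcal B}w_i$; $P=P_f$ and $Q=(\mathrm{sh}(P_0),\dots,\mathrm{sh}(P_f))$ (an up-down tableau: consecutive shapes differ by adding or removing one cell). Local rules, applied to a cell with vertices $A$ (top-left), $B$ (top-right), $C$ (bottom-left), $D$ (bottom-right), carrying shapes $\Lambda(\cdot)$, lying in a $\gamma$-stratum ($\gamma\in\Gamma_n$), with contents either empty or $\times$. The cases: carry-over (empty): all four equal; or $\Lambda(A)=\Lambda(B)\ne\Lambda(C)=\Lambda(D)$; or $\Lambda(A)=\Lambda(C)\ne\Lambda(B)=\Lambda(D)$. $(\times)$: contains $\times$, $\Lambda(A)=\Lambda(B)=\Lambda(C)\subset_1\Lambda(D)$. (M) empty, $k\ne k'$: $\Lambda(A)\subset_k\Lambda(B)$, $\Lambda(A)\subset_{k'}\Lambda(C)$, $\Lambda(B)\subset_{k'}\Lambda(D)$, $\Lambda(C)\subset_k\Lambda(D)$. (R) empty: $\Lambda(A)\subset_k\Lambda(B)=\Lambda(C)\subset_{k+1}\Lambda(D)$, $\gamma\ge k+1$. $(\bigcirc)$ empty: $\Lambda(A)\subset_k\Lambda(B)=\Lambda(C)\supset_k\Lambda(D)$, $\gamma\le\bar k$. $(\bar{\mathrm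 J})$ empty: $\Lambda(C)\subset\!\cdot\,\Lambda(A)\subset\!\cdot\,\Lambda(B)$, $\Lambda(C)\subset\!\cdot\,\Lambda(D)\subset\!\cdot\,\Lambda(B)$, $\Lambda(B)/\Lambda(C)$ a domino, $\Lambda(A)=\Lambda(D)$. (J) as $(\bar{\mathrm J})$ but not a domino and $\Lambda(A)\ne\Lambda(D)$. $(\bar{\mathrm J}')$ empty: $\Lambda(B)\subset\!\cdot\,\Lambda(A)\subset\!\cdot\,\Lambda(C)$, $\Lambda(B)\subset\!\cdot\,\Lambda(D)\subset\!\cdot\,\Lambda(C)$, $\Lambda(C)/\Lambda(B)$ a domino, $\Lambda(A)=\Lambda(D)$. (J$'$) as $(\bar{\mathrm J}')$ but not a domino and $\Lambda(A)\ne\Lambda(D)$. (W) empty, $k\ne k'$: $\Lambda(A)\supset_k\Lambda(B)$, $\Lambda(A)\supset_{k'}\Lambda(C)$, $\Lambda(B)\supset_{k'}\Lambda(D)$, $\Lambda(C)\supset_k\Lambda(D)$. (Ya) empty, $k\ge2$: $\Lambda(A)\supset_k\Lambda(B)=\Lambda(C)\supset_{k-1}\Lambda(D)$. Applying the local rules backwards means: given $\gamma$ and $\Lambda(B),\Lambda(C),\Lambda(D)$, take the case of this list compatible with these data and set $\Lambda(A)$ (and the cell contents) accordingly; "encountering case $(\bigcirc)$" means that this compatible case is $(\bigcirc)$.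
   Formalization: When applying the local rules backwards in the l̄-stratum, a case counts as compatible only if Λ(A) has at most l rows; without this, (○) and (Ya) with k = l+1 both match whenever Λ(B)=Λ(C) is Λ(D) plus a cell in row l, and (4) could fail. *)

theory Defs
  imports Main
begin

section \<open>Letters and symplectic tableaux\<close>

datatype letter = Unbarred (num: nat) | Barred (num: nat)

text \<open>The order \<open>1 < bar 1 < 2 < bar 2 < \<dots>\<close> is obtained by sending \<open>k\<close> to \<open>2k\<close> and
  \<open>bar k\<close> to \<open>2k + 1\<close>.\<close>

primrec letter_rank :: "letter \<Rightarrow> nat" where
  "letter_rank (Unbarred k) = 2 * k"
| "letter_rank (Barred k) = 2 * k + 1"

lemma letter_rank_eq_iff: "letter_rank x = letter_rank y \<longleftrightarrow> x = y"
  by (cases x; cases y) (auto, presburger+)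

instantiation letter :: linorder
begin

definition less_eq_letter :: "letter \<Rightarrow> letter \<Rightarrow> bool" where
  "x \<le> y \<longleftrightarrow> letter_rank x \<le> letter_rank y"

definition less_letter :: "letter \<Rightarrow> letter \<Rightarrow> bool" where
  "x < y \<longleftrightarrow> letter_rank x < letter_rank y"

instance
  by standard (auto simp: less_eq_letter_def less_letter_def letter_rank_eq_iff)

end

definition Gamma :: "nat \<Rightarrow> letter set" where
  "Gamma n = {x. 1 \<le> num x \<and> num x \<le> n}"

text \<open>A partition is the list of its nonzero parts, so its \<open>length\<close> is the number of nonzero parts.\<close>

type_synonym partition = "nat list"

definition is_partition :: "partition \<Rightarrow> bool" where
  "is_partition \<nu> \<longleftrightarrow> sorted_wrt (\<ge>) \<nu> \<and> (\<forall>p \<in> set \<nu>. 0 < p)"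

text \<open>A tableau is the list of its nonempty rows from top to bottom. List indices start at 0, hence
  the \<open>Suc i\<close> below and in the insertion algorithm wherever the number of a row matters.\<close>

type_synonym tableau = "letter list list"

definition shape :: "tableau \<Rightarrow> partition" where
  "shape T = map length T"

definition in_shape :: "tableau \<Rightarrow> nat \<Rightarrow> nat \<Rightarrow> bool" where
  "in_shape T i j \<longleftrightarrow> i < length T \<and> j < length (T ! i)"

definition entries :: "tableau \<Rightarrow> letter set" where
  "entries T = (\<Union>r \<in> set T. set r)"

definition sp_tableau :: "nat \<Rightarrow> tableau \<Rightarrow> bool" where
  "sp_tableau n T \<longleftrightarrow>
     is_partition (shape T) \<and>
     entries T \<subseteq> Gamma n \<and>
     (\<forall>r \<in> set T. sorted r) \<and>
     (\<forall>i j. in_shape T (Suc i) j \<longrightarrow> T ! i ! j < T ! Suc i ! j) \<and>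
     (\<forall>i j. in_shape T i j \<longrightarrow> Unbarred (Suc i) \<le> T ! i ! j)"


section \<open>Berele insertion\<close>

text \<open>Index of the leftmost entry strictly larger than \<open>x\<close>, or the length of the row if there is none.\<close>

definition bump_pos :: "letter \<Rightarrow> letter list \<Rightarrow> nat" where
  "bump_pos x r = length (takeWhile (\<lambda>y. \<not> x < y) r)"

fun row_insert :: "letter \<Rightarrow> tableau \<Rightarrow> tableau" where
  "row_insert x [] = [[x]]"
| "row_insert x (r # rs) =
     (let j = bump_pos x r in
      if j < length r then r[j := x] # row_insert (r ! j) rs
      else (r @ [x]) # rs)"

text \<open>\<open>cancel_stage i x T\<close> inserts \<open>x\<close> into \<open>T\<close>, whose first row is regarded as row \<open>Suc i\<close>, and stops
  at the earliest stage where a letter \<open>bar k\<close> of row \<open>k\<close> would be bumped by \<open>k\<close>. It returns the tableau at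
  that stage and the position of \<open>bar k\<close> (row index offset by \<open>i\<close>), which becomes the hole; the letter
  still stored there is never read afterwards.\<close>

fun cancel_stage :: "nat \<Rightarrow> letter \<Rightarrow> tableau \<Rightarrow> (tableau \<times> nat \<times> nat) option" where
  "cancel_stage i x [] = None"
| "cancel_stage i x (r # rs) =
     (let j = bump_pos x r in
      if j < length r then
        if x = Unbarred (Suc i) \<and> r ! j = Barred (Suc i) then Some (r # rs, i, j)
        else map_option (\<lambda>(rs', h). (r[j := x] # rs', h)) (cancel_stage (Suc i) (r ! j) rs)
      else None)"

definition remove_cell :: "nat \<Rightarrow> nat \<Rightarrow> tableau \<Rightarrow> tableau" where
  "remove_cell i j T = filter (\<lambda>r. r \<noteq> []) (T[i := take j (T ! i) @ drop (Suc j) (T ! i)])"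

function slide :: "tableau \<Rightarrow> nat \<Rightarrow> nat \<Rightarrow> tableau" where
  "slide T i j =
     (if in_shape T (Suc i) j \<and> (\<not> in_shape T i (Suc j) \<or> T ! Suc i ! j \<le> T ! i ! Suc j)
      then slide (T[i := (T ! i)[j := T ! Suc i ! j]]) (Suc i) j
      else if in_shape T i (Suc j)
      then slide (T[i := (T ! i)[j := T ! i ! Suc j]]) i (Suc j)
      else remove_cell i j T)"
  by pat_completeness auto

lemma map_length_update: "map length (T[i := (T ! i)[j := x]]) = map length T"
  by (metis length_list_update list_update_id map_update)

termination
proof (relation "measure (\<lambda>(T, i, j). (length T - i) + (sum_list (map length T) - j))", goal_cases)
  case 1
  show ?case by simp
next
  case (2 T i j)
  then show ?case
    by (simp only: in_measure prod.case map_length_update length_list_update in_shape_def) linarith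
next
  case (3 T i j)
  then have "i < length T" and j: "Suc j < length (T ! i)"
    by (auto simp: in_shape_def)
  then have "length (T ! i) \<le> sum_list (map length T)"
    by (intro member_le_sum_list) auto
  with j show ?case
    by (simp only: in_measure prod.case map_length_update length_list_update)
qed

declare slide.simps [simp del]

text \<open>If the row insertion result is not an \<open>Sp(2n)\<close>-tableau, a stage of the required kind exists as long
  as \<open>T\<close> is an \<open>Sp(2n)\<close>-tableau and \<open>x\<close> a letter in \<open>Gamma n\<close>; the value for \<open>None\<close> is a dummy.\<close>

definition berele_insert :: "nat \<Rightarrow> tableau \<Rightarrow> letter \<Rightarrow> tableau" where
  "berele_insert n T x =
     (if sp_tableau n (row_insert x T) then row_insert x T
      else case cancel_stage 0 x T of
             Some (T', i, j) \<Rightarrow> slide T' i j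
           | None \<Rightarrow> row_insert x T)"

definition berele_P :: "nat \<Rightarrow> letter list \<Rightarrow> tableau" where
  "berele_P n w = foldl (berele_insert n) [] w"

definition berele_Q :: "nat \<Rightarrow> letter list \<Rightarrow> partition list" where
  "berele_Q n w = map (\<lambda>i. shape (berele_P n (take i w))) [0..<Suc (length w)]"


section \<open>Deleting and adding letters\<close>

definition delete_rightmost_word :: "letter \<Rightarrow> letter list \<Rightarrow> letter list" where
  "delete_rightmost_word x w = rev (remove1 x (rev w))"

text \<open>The rightmost column containing \<open>x\<close> contains it only once, as columns are strictly increasing.\<close>

definition delete_rightmost :: "letter \<Rightarrow> tableau \<Rightarrow> tableau" where
  "delete_rightmost x T =
     (let j = Max {j. \<exists>i. in_shape T i j \<and> T ! i ! j = x};
          i = (THE i. in_shape T i j \<and> T ! i ! j = x)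
      in remove_cell i j T)"

text \<open>Adds \<open>x\<close> at the bottom of the leftmost column (possibly empty) that does not contain \<open>x\<close>. If \<open>T\<close> is
  an \<open>Sp(2n)\<close>-tableau with all letters at most \<open>x\<close>, the new cell is at the end of its row.\<close>

definition add_to_column :: "letter \<Rightarrow> tableau \<Rightarrow> tableau" where
  "add_to_column x T =
     (let j = (LEAST j. \<nexists>i. in_shape T i j \<and> T ! i ! j = x);
          h = card {i. in_shape T i j}
      in if h < length T then T[h := T ! h @ [x]] else T @ [[x]])"


section \<open>Local rules\<close>

definition cells :: "partition \<Rightarrow> (nat \<times> nat) set" where
  "cells \<nu> = {(i, j). 1 \<le> i \<and> i \<le> length \<nu> \<and> 1 \<le> j \<and> j \<le> \<nu> ! (i - 1)}"

text \<open>\<open>covered k \<mu> \<nu>\<close>: the partition \<open>\<nu>\<close> is \<open>\<mu>\<close> plus one cell in row \<open>k\<close> (rows numbered from 1).\<close>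

definition covered :: "nat \<Rightarrow> partition \<Rightarrow> partition \<Rightarrow> bool" where
  "covered k \<mu> \<nu> \<longleftrightarrow> is_partition \<mu> \<and> is_partition \<nu> \<and>
     (\<exists>j. (k, j) \<notin> cells \<mu> \<and> cells \<nu> = insert (k, j) (cells \<mu>))"

definition covered_some :: "partition \<Rightarrow> partition \<Rightarrow> bool" where
  "covered_some \<mu> \<nu> \<longleftrightarrow> (\<exists>k. covered k \<mu> \<nu>)"

definition is_domino :: "(nat \<times> nat) set \<Rightarrow> bool" where
  "is_domino S \<longleftrightarrow> (\<exists>i j. S = {(i, j), (i, Suc j)} \<or> S = {(i, j), (Suc i, j)})"

datatype content = Empty | Cross

datatype rule_case =
  Carry | RuleX | RuleM | RuleR | RuleO | RuleJbar | RuleJ | RuleJbar' | RuleJ' | RuleW | RuleYa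

text \<open>\<open>local_rule \<gamma> r A B C D c\<close>: a cell of the \<open>\<gamma>\<close>-stratum with contents \<open>c\<close> and shapes \<open>A\<close> (top-left),
  \<open>B\<close> (top-right), \<open>C\<close> (bottom-left), \<open>D\<close> (bottom-right) is an instance of the case \<open>r\<close>.\<close>

inductive local_rule ::
  "letter \<Rightarrow> rule_case \<Rightarrow> partition \<Rightarrow> partition \<Rightarrow> partition \<Rightarrow> partition \<Rightarrow> content \<Rightarrow> bool"
  for \<gamma> :: letter
where
  carry: "\<lbrakk>is_partition A; is_partition B; is_partition C; is_partition D;
     (A = B \<and> B = C \<and> C = D) \<or> (A = B \<and> B \<noteq> C \<and> C = D) \<or> (A = C \<and> C \<noteq> B \<and> B = D)\<rbrakk>
     \<Longrightarrow> local_rule \<gamma> Carry A B C D Empty"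
| X: "\<lbrakk>A = B; B = C; covered 1 C D\<rbrakk>
     \<Longrightarrow> local_rule \<gamma> RuleX A B C D Cross"
| M: "\<lbrakk>k \<noteq> k'; covered k A B; covered k' A C; covered k' B D; covered k C D\<rbrakk>
     \<Longrightarrow> local_rule \<gamma> RuleM A B C D Empty"
| R: "\<lbrakk>covered k A B; B = C; covered (k + 1) C D; \<gamma> \<ge> Unbarred (k + 1)\<rbrakk>
     \<Longrightarrow> local_rule \<gamma> RuleR A B C D Empty"
| O: "\<lbrakk>covered k A B; B = C; covered k D C; \<gamma> \<le> Barred k\<rbrakk>
     \<Longrightarrow> local_rule \<gamma> RuleO A B C D Empty"
| Jbar: "\<lbrakk>covered_some C A; covered_some A B; covered_some C D; covered_some D B;
     is_domino (cells B - cells C); A = D\<rbrakk>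
     \<Longrightarrow> local_rule \<gamma> RuleJbar A B C D Empty"
| J: "\<lbrakk>covered_some C A; covered_some A B; covered_some C D; covered_some D B;
     \<not> is_domino (cells B - cells C); A \<noteq> D\<rbrakk>
     \<Longrightarrow> local_rule \<gamma> RuleJ A B C D Empty"
| Jbar': "\<lbrakk>covered_some B A; covered_some A C; covered_some B D; covered_some D C;
     is_domino (cells C - cells B); A = D\<rbrakk>
     \<Longrightarrow> local_rule \<gamma> RuleJbar' A B C D Empty"
| J': "\<lbrakk>covered_some B A; covered_some A C; covered_some B D; covered_some D C;
     \<not> is_domino (cells C - cells B); A \<noteq> D\<rbrakk>
     \<Longrightarrow> local_rule \<gamma> RuleJ' A B C D Empty"
| W: "\<lbrakk>k \<noteq> k'; covered k B A; covered k' C A; covered k' D B; covered k D C\<rbrakk>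
     \<Longrightarrow> local_rule \<gamma> RuleW A B C D Empty"
| Ya: "\<lbrakk>k \<ge> 2; covered k B A; B = C; covered (k - 1) D C\<rbrakk>
     \<Longrightarrow> local_rule \<gamma> RuleYa A B C D Empty"

text \<open>Applying the rules backwards. In the \<open>m\<close>- and \<open>bar m\<close>-strata all shapes are shapes of symplectic
  tableaux with letters at most \<open>bar m\<close>, so they have at most \<open>m\<close> rows, and a case yielding a longer
  \<open>A\<close> is not compatible with the stratum. This matters when \<open>B = C\<close> is \<open>D\<close> plus a cell in row \<open>m\<close>: both
  (O) and (Ya) with \<open>k = m + 1\<close> match the three shapes, and only (O) is compatible.\<close>

definition backward_rule ::
  "letter \<Rightarrow> partition \<Rightarrow> partition \<Rightarrow> partition \<Rightarrow> rule_case \<Rightarrow> partition \<Rightarrow> bool" where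
  "backward_rule \<gamma> B C D r A \<longleftrightarrow> (\<exists>c. local_rule \<gamma> r A B C D c) \<and> length A \<le> num \<gamma>"

text \<open>\<open>backward_test \<kappa> \<gamma> f \<sigma>f j \<sigma>\<close>: the backward test in the \<open>\<gamma>\<close>-stratum along \<open>\<kappa>\<close>, started with \<open>\<sigma>f\<close>
  at position \<open>f\<close>, produces \<open>\<sigma>\<close> at position \<open>j\<close>.\<close>

inductive backward_test ::
  "partition list \<Rightarrow> letter \<Rightarrow> nat \<Rightarrow> partition \<Rightarrow> nat \<Rightarrow> partition \<Rightarrow> bool"
  for \<kappa> :: "partition list" and \<gamma> :: letter and f :: nat and \<sigma>f :: partition
where
  start: "backward_test \<kappa> \<gamma> f \<sigma>f f \<sigma>f"
| step: "\<lbrakk>backward_test \<kappa> \<gamma> f \<sigma>f j \<sigma>; 1 \<le> j; covered_some (\<kappa> ! j) \<sigma>;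
     backward_rule \<gamma> \<sigma> (\<kappa> ! (j - 1)) (\<kappa> ! j) r A\<rbrakk>
     \<Longrightarrow> backward_test \<kappa> \<gamma> f \<sigma>f (j - 1) A"

definition test_reaches_left_edge ::
  "partition list \<Rightarrow> letter \<Rightarrow> nat \<Rightarrow> partition \<Rightarrow> bool" where
  "test_reaches_left_edge \<kappa> \<gamma> f \<sigma>f \<longleftrightarrow>
     (\<exists>\<sigma>. backward_test \<kappa> \<gamma> f \<sigma>f 0 \<sigma> \<and> covered_some (\<kappa> ! 0) \<sigma>)"

definition test_encounters ::
  "rule_case \<Rightarrow> partition list \<Rightarrow> letter \<Rightarrow> nat \<Rightarrow> partition \<Rightarrow> bool" where
  "test_encounters r \<kappa> \<gamma> f \<sigma>f \<longleftrightarrow>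
     (\<exists>j \<sigma> A. backward_test \<kappa> \<gamma> f \<sigma>f j \<sigma> \<and> 1 \<le> j \<and> covered_some (\<kappa> ! j) \<sigma> \<and>
        backward_rule \<gamma> \<sigma> (\<kappa> ! (j - 1)) (\<kappa> ! j) r A)"

end

theory Submission
  imports Defs
begin

text \<open>
  A tableau \<open>T\<close> whose letters are at most \<open>x\<close> is determined by its part \<open>S\<close> with letters below \<open>x\<close>
  and by its shape \<open>\<nu>\<close>, the letters \<open>x\<close> filling the horizontal strip \<open>\<nu> / sh S\<close>. Inserting \<open>y < x\<close> into
  \<open>T\<close> acts on \<open>S\<close> as the insertion into \<open>S\<close>, and \<open>\<nu>\<close> moves by a rule depending only on \<open>\<nu>\<close> and the
  cell added to or removed from \<open>S\<close>; this also shows by induction on the largest letter that Berele insertion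
  preserves symplectic tableaux.

  Let \<open>x\<close> be the largest letter of \<open>w\<close>, and run \<open>w\<close> in parallel with \<open>w\<close> without its last \<open>x\<close>. Both
  tableaux have the same \<open>S\<close>, and their shapes differ by the topmost cell of the strip, until possibly
  \<open>x = bar l\<close> is cancelled by a letter \<open>l\<close> in row \<open>l\<close>. From then on the roles are exchanged: the tableau of the
  shortened word has one more cell, which contains \<open>l\<close> and lies at the bottom of the leftmost column without \<open>l\<close>.
  In that phase the shapes are forced by the local rules applied backwards, so the backward test retraces them
  down to the cancellation, where only (O) is compatible. If \<open>x = l\<close> instead, the same phase is realised
  over all of \<open>w\<close> by the word \<open>l w\<close>, so the test never meets (O).
\<close>

section \<open>Symplectic fillings and strips of a largest letter\<close>

text \<open>The number \<open>l\<close> detects \<open>num x\<close> without knowledge of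
  \<open>w\<close>: no intermediate tableau has more than \<open>num x\<close> rows, so
  \<open>l \<le> num x\<close>, and a largest letter \<open>x\<close> can be cancelled only in row
  \<open>num x\<close>, so a cancellation forces equality. If the tracked \<open>x\<close> survives,
  it is the largest letter of \<open>P\<close>, whence \<open>m = num x \<ge> l\<close>. Thus
  \<open>m > l\<close> excludes a cancellation, and the real ambiguity is between a surviving
  \<open>x = l\<close> and a cancelled \<open>bar l\<close>.

  In both alternatives, adding \<open>l\<close> to \<open>P\<close> gives the Berele tableau of
  another word. The shapes to be retraced are therefore known in advance, and the test needs no
  analysis beyond determinism of the backward rules along them.

  Fillings have infinitely many rows, so that opening a new row is not a special case. Insertion is
  a relation on them, because inductions over its stages must keep track of the final row and of the
  appended letter, and because the existence of a symplectic outcome is itself something to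
  prove.\<close>

type_synonym filling = "nat \<Rightarrow> letter list"

definition letters :: "filling \<Rightarrow> letter set" where
  "letters R = (\<Union>i. set (R i))"

definition symplectic :: "filling \<Rightarrow> bool" where
  "symplectic R \<longleftrightarrow>
     (\<forall>i. sorted (R i)) \<and> (\<forall>i. length (R (Suc i)) \<le> length (R i)) \<and>
     (\<forall>i j. j < length (R (Suc i)) \<longrightarrow> R i ! j < R (Suc i) ! j) \<and>
     (\<forall>i. \<forall>a \<in> set (R i). Unbarred (Suc i) \<le> a)"

definition fill :: "letter \<Rightarrow> filling \<Rightarrow> (nat \<Rightarrow> nat) \<Rightarrow> filling" where
  "fill x S \<nu> i = S i @ replicate (\<nu> i - length (S i)) x"

text \<open>Interlacing with the row lengths of \<open>S\<close> is the horizontal strip condition;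
  the last clause is the symplectic bound for the letters \<open>x\<close>. Only the row lengths of
  \<open>S\<close> enter, so the condition persists through the intermediate fillings of a
  slide.\<close>

definition strip :: "letter \<Rightarrow> filling \<Rightarrow> (nat \<Rightarrow> nat) \<Rightarrow> bool" where
  "strip x S \<nu> \<longleftrightarrow>
     (\<forall>i. length (S i) \<le> \<nu> i \<and> \<nu> (Suc i) \<le> length (S i) \<and>
       (length (S i) < \<nu> i \<longrightarrow> Unbarred (Suc i) \<le> x))"

definition restrict_below :: "letter \<Rightarrow> filling \<Rightarrow> filling" where
  "restrict_below x R i = takeWhile (\<lambda>a. a < x) (R i)"

lemma letters_fill: "letters (fill x S \<nu>) \<subseteq> insert x (letters S)"
  by (auto simp: letters_def fill_def)

lemma length_fill: "strip x S \<nu> \<Longrightarrow> length (fill x S \<nu> i) = \<nu> i"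
  by (simp add: strip_def fill_def)

text \<open>Interlacing puts a letter of \<open>S\<close> above every cell of the next row, so no
  two letters \<open>x\<close> share a column.\<close>

lemma symplectic_fill:
  assumes S: "symplectic S" and lt: "\<forall>a \<in> letters S. a < x" and st: "strip x S \<nu>"
  shows "symplectic (fill x S \<nu>)"
proof -
  have x: "\<And>i a. a \<in> set (S i) \<Longrightarrow> a < x" using lt by (auto simp: letters_def)
  have x_nth: "\<And>i j. j < length (S i) \<Longrightarrow> S i ! j < x" using x nth_mem by blast
  have "sorted (fill x S \<nu> i)" for i
    using S x[of _ i] by (auto simp: symplectic_def fill_def sorted_append less_imp_le)
  moreover have "length (fill x S \<nu> (Suc i)) \<le> length (fill x S \<nu> i)" for i
    using st unfolding length_fill[OF st] strip_def by (meson le_trans)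
  moreover have "fill x S \<nu> i ! j < fill x S \<nu> (Suc i) ! j" if j: "j < length (fill x S \<nu> (Suc i))" for i j
  proof -
    have jS: "j < length (S i)" using st j unfolding length_fill[OF st] strip_def by (meson less_le_trans)
    then have "S i ! j < x" by (rule x_nth)
    with S j jS show ?thesis by (auto simp: symplectic_def fill_def nth_append)
  qed
  moreover have "Unbarred (Suc i) \<le> a" if "a \<in> set (fill x S \<nu> i)" for i a
    using that S st by (auto simp: symplectic_def fill_def strip_def split: if_splits)
  ultimately show ?thesis by (simp add: symplectic_def)
qed

lemma fill_restrict_below:
  assumes R: "symplectic R" and le: "\<forall>a \<in> letters R. a \<le> x"
  shows "fill x (restrict_below x R) (\<lambda>i. length (R i)) = R"
    and "strip x (restrict_below x R) (\<lambda>i. length (R i))"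
    and "symplectic (restrict_below x R)"
    and "\<forall>a \<in> letters (restrict_below x R). a < x"
proof -
  let ?S = "restrict_below x R"
  have drop: "dropWhile (\<lambda>a. a < x) (R i) = replicate (length (R i) - length (?S i)) x" for i
  proof -
    let ?d = "dropWhile (\<lambda>a. a < x) (R i)"
    have "\<forall>a \<in> set ?d. a = x"
    proof
      fix a assume a: "a \<in> set ?d"
      then have "a \<in> set (R i)" by (metis Un_iff set_append takeWhile_dropWhile_id)
      then have ax: "a \<le> x" using le by (auto simp: letters_def)
      have ne: "?d \<noteq> []" using a by (metis empty_iff empty_set)
      have "sorted ?d" using R by (simp add: symplectic_def sorted_dropWhile)
      then have "hd ?d \<le> a" using a by (cases ?d) auto
      moreover have "\<not> hd ?d < x" using hd_dropWhile[OF ne] .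
      ultimately show "a = x" using ax by simp
    qed
    then have "?d = replicate (length ?d) x" by (metis replicate_length_same)
    moreover have "length (R i) = length (?S i) + length ?d"
      by (metis length_append restrict_below_def takeWhile_dropWhile_id)
    ultimately show ?thesis by simp
  qed
  show fr: "fill x ?S (\<lambda>i. length (R i)) = R"
    by (rule ext) (simp add: fill_def drop[symmetric], simp add: restrict_below_def)
  show lt: "\<forall>a \<in> letters ?S. a < x"
    by (auto simp: letters_def restrict_below_def dest: set_takeWhileD)
  have l1: "length (?S i) \<le> length (R i)" for i by (simp add: restrict_below_def length_takeWhile_le)
  have nth: "?S i ! j = R i ! j" if "j < length (?S i)" for i j
    using that by (simp add: restrict_below_def takeWhile_nth)
  \<comment> \<open>The first cell of row \<open>i\<close> outside \<open>?S\<close> holds a letter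
    that is not below \<open>x\<close>, and a cell under it would need a still larger
    letter.\<close>
  have l2: "length (R (Suc i)) \<le> length (?S i)" for i
  proof (rule ccontr)
    assume "\<not> ?thesis"
    then have j: "length (?S i) < length (R (Suc i))" by simp
    moreover from R have "length (R (Suc i)) \<le> length (R i)" by (simp add: symplectic_def)
    ultimately have "\<not> R i ! length (?S i) < x"
      unfolding restrict_below_def by (intro nth_length_takeWhile) simp
    moreover have "R i ! length (?S i) < R (Suc i) ! length (?S i)" using R j by (simp add: symplectic_def)
    moreover have "R (Suc i) ! length (?S i) \<le> x" using le nth_mem[OF j] by (auto simp: letters_def)
    ultimately show False by simp
  qed
  have ub: "Unbarred (Suc i) \<le> x" if j: "length (?S i) < length (R i)" for i
  proof -
    have "R i ! length (?S i) \<in> set (R i)" using j by simp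
    then have "R i ! length (?S i) \<le> x" "Unbarred (Suc i) \<le> R i ! length (?S i)"
      using R le by (auto simp: symplectic_def letters_def)
    then show ?thesis by simp
  qed
  show "strip x ?S (\<lambda>i. length (R i))" using l1 l2 ub by (simp add: strip_def)
  have "length (?S (Suc i)) \<le> length (?S i)" for i using l1[of "Suc i"] l2[of i] by simp
  moreover have "?S i ! j < ?S (Suc i) ! j" if j: "j < length (?S (Suc i))" for i j
  proof -
    have "j < length (R (Suc i))" "j < length (?S i)" using j l1[of "Suc i"] l2[of i] by simp_all
    then show ?thesis using R j by (simp add: nth symplectic_def)
  qed
  moreover have "sorted (?S i)" for i using R by (simp add: symplectic_def restrict_below_def sorted_takeWhile)
  moreover have "Unbarred (Suc i) \<le> a" if "a \<in> set (?S i)" for i a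
    using R that by (auto simp: symplectic_def restrict_below_def dest: set_takeWhileD)
  ultimately show "symplectic ?S" by (simp add: symplectic_def)
qed

text \<open>\<open>insertion i y R k t R'\<close>: row insertion of \<open>y\<close>, starting with row \<open>i\<close>, ends by appending \<open>t\<close>
  to row \<open>k\<close>, and no cancellation occurs. Rows are numbered from 0 here.\<close>

inductive insertion ::
  "nat \<Rightarrow> letter \<Rightarrow> filling \<Rightarrow> nat \<Rightarrow> letter \<Rightarrow> filling \<Rightarrow> bool"
where
  insertion_stop: "\<forall>a \<in> set (R i). a \<le> y \<Longrightarrow> insertion i y R i y (R(i := R i @ [y]))"
| insertion_bump: "\<lbrakk>R i = u @ z # v; \<forall>a \<in> set u. a \<le> y; y < z;
     \<not> (y = Unbarred (Suc i) \<and> z = Barred (Suc i)); insertion (Suc i) z R k t R'\<rbrakk>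
     \<Longrightarrow> insertion i y R k t (R'(i := u @ y # v))"

text \<open>The barred letter stays in the hole as a placeholder: \<open>sliding\<close> only
  overwrites or drops that cell, so row lengths do not change before the slide ends.\<close>

inductive cancellation ::
  "nat \<Rightarrow> letter \<Rightarrow> filling \<Rightarrow> filling \<Rightarrow> nat \<Rightarrow> nat \<Rightarrow> bool"
where
  cancellation_here: "\<lbrakk>R i = u @ Barred (Suc i) # v; \<forall>a \<in> set u. a \<le> Unbarred (Suc i)\<rbrakk>
     \<Longrightarrow> cancellation i (Unbarred (Suc i)) R R i (length u)"
| cancellation_bump: "\<lbrakk>R i = u @ z # v; \<forall>a \<in> set u. a \<le> y; y < z;
     \<not> (y = Unbarred (Suc i) \<and> z = Barred (Suc i)); cancellation (Suc i) z R R' p q\<rbrakk>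
     \<Longrightarrow> cancellation i y R (R'(i := u @ y # v)) p q"

text \<open>In \<open>sliding R i j k R'\<close> the argument \<open>k\<close> records the row that
  finally loses its last cell.\<close>

inductive sliding :: "filling \<Rightarrow> nat \<Rightarrow> nat \<Rightarrow> nat \<Rightarrow> filling \<Rightarrow> bool"
where
  sliding_down: "\<lbrakk>j < length (R i); j < length (R (Suc i));
     Suc j < length (R i) \<longrightarrow> R (Suc i) ! j \<le> R i ! Suc j;
     sliding (R(i := (R i)[j := R (Suc i) ! j])) (Suc i) j k R'\<rbrakk> \<Longrightarrow> sliding R i j k R'"
| sliding_right: "\<lbrakk>Suc j < length (R i); j < length (R (Suc i)) \<longrightarrow> R i ! Suc j < R (Suc i) ! j;
     sliding (R(i := (R i)[j := R i ! Suc j])) i (Suc j) k R'\<rbrakk> \<Longrightarrow> sliding R i j k R'"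
| sliding_stop: "\<lbrakk>Suc j = length (R i); length (R (Suc i)) \<le> j\<rbrakk>
     \<Longrightarrow> sliding R i j i (R(i := butlast (R i)))"

section \<open>Row lengths and letters under insertion, cancellation and sliding\<close>

lemma insertion_facts:
  assumes "insertion i y R k t R'"
  shows "i \<le> k \<and> R' k = R k @ [t] \<and> (\<forall>q < i. R' q = R q) \<and>
    (\<forall>q. length (R' q) = (if q = k then Suc (length (R q)) else length (R q))) \<and>
    letters R' \<subseteq> insert y (letters R) \<and> t \<in> insert y (letters R)"
  using assms
proof induction
  case (insertion_stop R i y)
  then show ?case by (auto simp: letters_def split: if_splits)
next
  case (insertion_bump R i u z v y k t R')
  have z: "z \<in> letters R" "set u \<subseteq> letters R" "set v \<subseteq> letters R"
    using insertion_bump.hyps(1) by (auto simp: letters_def intro!: exI[of _ i])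
  have "letters (R'(i := u @ y # v)) \<subseteq> letters R' \<union> set u \<union> set v \<union> {y}"
    by (auto simp: letters_def split: if_splits)
  then have "letters (R'(i := u @ y # v)) \<subseteq> insert y (letters R)" using insertion_bump.IH z by blast
  then show ?case using insertion_bump.hyps(1) insertion_bump.IH z(1) by (auto simp del: fun_upd_apply simp: fun_upd_def[abs_def] subset_iff)
qed

lemma cancellation_facts:
  assumes "cancellation i y R R' p q"
  shows "i \<le> p \<and> q < length (R' p) \<and> (\<forall>r. length (R' r) = length (R r)) \<and>
    letters R' \<subseteq> insert y (letters R)"
  using assms
proof induction
  case (cancellation_here R i u v)
  then show ?case by auto
next
  case (cancellation_bump R i u z v y R' p q)
  have z: "z \<in> letters R" "set u \<subseteq> letters R" "set v \<subseteq> letters R"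
    using cancellation_bump.hyps(1) by (auto simp: letters_def intro!: exI[of _ i])
  have "letters (R'(i := u @ y # v)) \<subseteq> letters R' \<union> set u \<union> set v \<union> {y}"
    by (auto simp: letters_def split: if_splits)
  then have "letters (R'(i := u @ y # v)) \<subseteq> insert y (letters R)" using cancellation_bump.IH z by blast
  then show ?case using cancellation_bump.hyps(1) cancellation_bump.IH z(1) by (auto simp del: fun_upd_apply simp: fun_upd_def[abs_def] subset_iff)
qed

lemma sliding_facts:
  assumes "sliding R i j k R'"
  shows "length (R k) > 0 \<and>
    (\<forall>q. length (R' q) = (if q = k then length (R q) - 1 else length (R q))) \<and>
    letters R' \<subseteq> letters R"
  using assms
proof induction
  case (sliding_down j R i k R')
  have "letters (R(i := (R i)[j := R (Suc i) ! j])) \<subseteq> letters R"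
    using nth_mem[OF sliding_down.hyps(2)] set_update_subset_insert[of "R i" j "R (Suc i) ! j"]
    by (auto simp: letters_def split: if_splits) blast+
  then have "letters R' \<subseteq> letters R" using sliding_down.IH by blast
  then show ?case using sliding_down.IH by (auto split: if_splits)
next
  case (sliding_right j R i k R')
  have "letters (R(i := (R i)[j := R i ! Suc j])) \<subseteq> letters R"
    using nth_mem[OF sliding_right.hyps(1)] set_update_subset_insert[of "R i" j "R i ! Suc j"]
    by (auto simp: letters_def split: if_splits) blast+
  then have "letters R' \<subseteq> letters R" using sliding_right.IH by blast
  then show ?case using sliding_right.IH by (auto split: if_splits)
next
  case (sliding_stop j R i)
  then show ?case by (fastforce simp: letters_def split: if_splits dest: in_set_butlastD)
qed

section \<open>One insertion, cancellation or slide in the presence of a strip of largest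
  letters\<close>

lemma insertion_fill_append:
  assumes "insertion i y S k t S'" and "\<forall>a \<in> letters S. a < x" and "y < x"
    and "\<nu> k = length (S k)" and "\<forall>q. length (S q) \<le> \<nu> q"
  shows "insertion i y (fill x S \<nu>) k t (fill x S' (\<nu>(k := Suc (\<nu> k))))"
  using assms
proof induction
  case (insertion_stop S i y)
  have "(fill x S \<nu>)(i := fill x S \<nu> i @ [y]) = fill x (S(i := S i @ [y])) (\<nu>(i := Suc (\<nu> i)))"
    using insertion_stop by (auto simp: fill_def)
  moreover have "\<forall>a \<in> set (fill x S \<nu> i). a \<le> y" using insertion_stop by (simp add: fill_def)
  ultimately show ?case using insertion.insertion_stop[of "fill x S \<nu>" i y] insertion_stop.prems(3) by (simp add: fill_def[of _ _ _ i] del: fun_upd_apply)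
next
  case (insertion_bump S i u z v y k t S')
  let ?w = "replicate (\<nu> i - length (S i)) x"
  have z: "z < x" using insertion_bump.hyps(1) insertion_bump.prems(1) by (auto simp: letters_def dest: spec[of _ i])
  have "i < k" using insertion_facts[OF insertion_bump.hyps(5)] by simp
  then have "(fill x S' (\<nu>(k := Suc (\<nu> k))))(i := u @ y # v @ ?w)
      = fill x (S'(i := u @ y # v)) (\<nu>(k := Suc (\<nu> k)))"
    using insertion_bump.hyps(1) by (auto simp: fill_def)
  moreover have "insertion i y (fill x S \<nu>) k t ((fill x S' (\<nu>(k := Suc (\<nu> k))))(i := u @ y # v @ ?w))"
    using insertion_bump z
    by (intro insertion.insertion_bump[where z = z]) (auto simp: fill_def[of _ _ _ i] simp del: fun_upd_apply)
  ultimately show ?case by (simp del: fun_upd_apply)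
qed

text \<open>Up to row \<open>k\<close> the bumped letters stand left of the strip, so the insertion
  runs as in \<open>S\<close>. There \<open>t\<close> meets the first \<open>x\<close>, which is
  maximal and hence can only be appended to the next row. The excluded pair is the one that
  cancels.\<close>

lemma insertion_fill_bump:
  assumes "insertion i y S k t S'" and "\<forall>a \<in> letters S. a < x" and "y < x"
    and "length (S k) < \<nu> k" and "\<forall>q. length (S q) \<le> \<nu> q"
    and "\<not> (t = Unbarred (Suc k) \<and> x = Barred (Suc k))"
  shows "insertion i y (fill x S \<nu>) (Suc k) x (fill x S' (\<nu>(Suc k := Suc (\<nu> (Suc k)))))"
  using assms
proof induction
  case (insertion_stop S i y)
  let ?R = "fill x S \<nu>"
  have row: "?R i = S i @ x # replicate (\<nu> i - Suc (length (S i))) x"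
    using insertion_stop.prems(3) by (simp add: fill_def flip: replicate_Suc Suc_diff_Suc)
  have "\<forall>a \<in> set (?R (Suc i)). a \<le> x"
    using insertion_stop.prems(1) by (auto simp: fill_def letters_def less_imp_le)
  from insertion.insertion_bump[of ?R, OF row _ _ _ insertion.insertion_stop[of ?R "Suc i", OF this]]
  have "insertion i y ?R (Suc i) x
      (?R(Suc i := ?R (Suc i) @ [x], i := S i @ y # replicate (\<nu> i - Suc (length (S i))) x))"
    using insertion_stop by auto
  moreover have "?R(Suc i := ?R (Suc i) @ [x], i := S i @ y # replicate (\<nu> i - Suc (length (S i))) x)
      = fill x (S(i := S i @ [y])) (\<nu>(Suc i := Suc (\<nu> (Suc i))))"
    using insertion_stop.prems(4) by (auto simp: fill_def Suc_diff_le replicate_append_same)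
  ultimately show ?case by (simp del: fun_upd_apply)
next
  case (insertion_bump S i u z v y k t S')
  let ?w = "replicate (\<nu> i - length (S i)) x"
  have z: "z < x" using insertion_bump.hyps(1) insertion_bump.prems(1) by (auto simp: letters_def dest: spec[of _ i])
  have "i < k" using insertion_facts[OF insertion_bump.hyps(5)] by simp
  then have "(fill x S' (\<nu>(Suc k := Suc (\<nu> (Suc k)))))(i := u @ y # v @ ?w)
      = fill x (S'(i := u @ y # v)) (\<nu>(Suc k := Suc (\<nu> (Suc k))))"
    using insertion_bump.hyps(1) by (auto simp: fill_def)
  moreover have "insertion i y (fill x S \<nu>) (Suc k) x ((fill x S' (\<nu>(Suc k := Suc (\<nu> (Suc k)))))(i := u @ y # v @ ?w))"
    using insertion_bump z
    by (intro insertion.insertion_bump[where z = z]) (auto simp: fill_def[of _ _ _ i] simp del: fun_upd_apply)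
  ultimately show ?case by (simp del: fun_upd_apply)
qed

text \<open>Row \<open>k\<close> is reset to \<open>S k\<close> because the letter \<open>t\<close>,
  appended there by the insertion into \<open>S\<close>, now disappears together with the first
  \<open>x\<close>. The hole is the place of that \<open>x\<close>, just behind
  \<open>S k\<close>.\<close>

lemma cancellation_fill_new:
  assumes "insertion i y S k t S'" and "\<forall>a \<in> letters S. a < x" and "y < x"
    and "length (S k) < \<nu> k" and "t = Unbarred (Suc k)" and "x = Barred (Suc k)"
  shows "cancellation i y (fill x S \<nu>) (fill x (S'(k := S k)) \<nu>) k (length (S k))"
  using assms
proof induction
  case (insertion_stop S i y)
  let ?R = "fill x S \<nu>"
  have row: "?R i = S i @ Barred (Suc i) # replicate (\<nu> i - Suc (length (S i))) x"
    using insertion_stop.prems by (simp add: fill_def flip: replicate_Suc Suc_diff_Suc)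
  show ?case
    using cancellation_here[of ?R, OF row] insertion_stop by (simp del: fun_upd_apply)
next
  case (insertion_bump S i u z v y k t S')
  let ?w = "replicate (\<nu> i - length (S i)) x"
  have z: "z < x" using insertion_bump.hyps(1) insertion_bump.prems(1) by (auto simp: letters_def dest: spec[of _ i])
  have "i < k" using insertion_facts[OF insertion_bump.hyps(5)] by simp
  then have "(fill x (S'(k := S k)) \<nu>)(i := u @ y # v @ ?w)
      = fill x (S'(i := u @ y # v, k := S k)) \<nu>"
    using insertion_bump.hyps(1) by (auto simp: fill_def)
  moreover have "cancellation i y (fill x S \<nu>) ((fill x (S'(k := S k)) \<nu>)(i := u @ y # v @ ?w)) k (length (S k))"
    using insertion_bump z
    by (intro cancellation_bump[where z = z]) (auto simp: fill_def[of _ _ _ i] simp del: fun_upd_apply)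
  ultimately show ?case by (simp del: fun_upd_apply)
qed

lemma cancellation_fill:
  assumes "cancellation i y S S' p q"
  shows "cancellation i y (fill x S \<nu>) (fill x S' \<nu>) p q"
  using assms
proof induction
  case (cancellation_here S i u v)
  then show ?case
    using cancellation.cancellation_here[of "fill x S \<nu>" i u "v @ replicate (\<nu> i - length (S i)) x"]
    by (simp add: fill_def[of _ _ _ i])
next
  case (cancellation_bump S i u z v y S' p q)
  let ?w = "replicate (\<nu> i - length (S i)) x"
  have "(fill x S' \<nu>)(i := u @ y # v @ ?w) = fill x (S'(i := u @ y # v)) \<nu>"
    using cancellation_bump.hyps(1) by (auto simp: fill_def)
  moreover have "cancellation i y (fill x S \<nu>) ((fill x S' \<nu>)(i := u @ y # v @ ?w)) p q"
    using cancellation_bump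
    by (intro cancellation.cancellation_bump[where z = z]) (auto simp: fill_def[of _ _ _ i] simp del: fun_upd_apply)
  ultimately show ?case by (simp del: fun_upd_apply)
qed

text \<open>\<open>g\<close> is the placeholder in the hole. With nothing below and only copies of
  \<open>x\<close> to the right, the slide amounts to erasing \<open>g\<close>.\<close>

lemma sliding_right_end:
  assumes "R i = u @ g # replicate m x" and "length (R (Suc i)) \<le> length u"
  shows "sliding R i (length u) i (R(i := u @ replicate m x))"
  using assms
proof (induction m arbitrary: R u g)
  case 0
  then show ?case using sliding_stop[of "length u" R i] by (simp del: fun_upd_apply)
next
  case (Suc m)
  let ?R = "R(i := (R i)[length u := R i ! Suc (length u)])"
  have "?R i = (u @ [x]) @ x # replicate m x" using Suc.prems(1) by (simp add: nth_append)
  from Suc.IH[of ?R, OF this] Suc.prems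
  have "sliding ?R i (Suc (length u)) i (?R(i := (u @ [x]) @ replicate m x))"
    by (simp del: fun_upd_apply add: fun_upd_other)
  then have "sliding R i (length u) i (?R(i := (u @ [x]) @ replicate m x))"
    using Suc.prems by (intro sliding_right[of "length u" R i]) auto
  then show ?case by (simp del: fun_upd_apply)
qed

text \<open>The slide in \<open>S\<close> ends at the last cell of row \<open>k\<close>, and the
  hypothesis on \<open>\<nu>\<close> puts an \<open>x\<close> directly below it. A right neighbour
  can only be another \<open>x\<close>, and ties favour the lower letter, so the hole moves down
  once more.\<close>

lemma sliding_fill_below:
  assumes "sliding S i j k S'" and "\<forall>a \<in> letters S. a < x" and "strip x S \<nu>"
    and "\<nu> (Suc k) = length (S k)"
  shows "sliding (fill x S \<nu>) i j (Suc k) (fill x S' (\<nu>(Suc k := \<nu> (Suc k) - 1)))"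
  using assms
proof induction
  case (sliding_down j S i k S')
  let ?S = "S(i := (S i)[j := S (Suc i) ! j])"
  have e: "(fill x S \<nu>)(i := (fill x S \<nu> i)[j := fill x S \<nu> (Suc i) ! j]) = fill x ?S \<nu>"
    using sliding_down.hyps by (auto simp: fill_def nth_append list_update_append)
  have len: "\<And>q. length (?S q) = length (S q)" by simp
  have "letters ?S \<subseteq> letters S"
    using nth_mem[OF sliding_down.hyps(2)] set_update_subset_insert[of "S i" j "S (Suc i) ! j"]
    by (auto simp: letters_def split: if_splits) blast+
  then have "sliding (fill x ?S \<nu>) (Suc i) j (Suc k) (fill x S' (\<nu>(Suc k := \<nu> (Suc k) - 1)))"
    using sliding_down.prems len by (intro sliding_down.IH) (auto simp: strip_def simp del: fun_upd_apply)
  moreover have "S (Suc i) ! j < x"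
    using nth_mem[OF sliding_down.hyps(2)] sliding_down.prems(1) by (auto simp: letters_def)
  ultimately show ?case
    using sliding_down.hyps(1-3) unfolding e[symmetric]
    by (intro sliding.sliding_down[of j "fill x S \<nu>" i])
      (auto simp: fill_def[of _ _ _ i] fill_def[of _ _ _ "Suc i"] nth_append simp del: fun_upd_apply)
next
  case (sliding_right j S i k S')
  let ?S = "S(i := (S i)[j := S i ! Suc j])"
  have e: "(fill x S \<nu>)(i := (fill x S \<nu> i)[j := fill x S \<nu> i ! Suc j]) = fill x ?S \<nu>"
    using sliding_right.hyps by (auto simp: fill_def nth_append list_update_append)
  have len: "\<And>q. length (?S q) = length (S q)" by simp
  have "letters ?S \<subseteq> letters S"
    using nth_mem[OF sliding_right.hyps(1)] set_update_subset_insert[of "S i" j "S i ! Suc j"]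
    by (auto simp: letters_def split: if_splits) blast+
  then have "sliding (fill x ?S \<nu>) i (Suc j) (Suc k) (fill x S' (\<nu>(Suc k := \<nu> (Suc k) - 1)))"
    using sliding_right.prems len by (intro sliding_right.IH) (auto simp: strip_def simp del: fun_upd_apply)
  moreover have "S i ! Suc j < x"
    using nth_mem[OF sliding_right.hyps(1)] sliding_right.prems(1) by (auto simp: letters_def)
  ultimately show ?case
    using sliding_right.hyps(1-2) unfolding e[symmetric]
    by (intro sliding.sliding_right[of j "fill x S \<nu>" i])
      (auto simp: fill_def[of _ _ _ i] fill_def[of _ _ _ "Suc i"] nth_append simp del: fun_upd_apply)
next
  case (sliding_stop j S i)
  let ?R = "fill x S \<nu>"
  \<comment> \<open>Row \<open>Suc i\<close> ends exactly below the hole and the row after it does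
    not reach column \<open>j\<close>, so one step down ends the slide.\<close>
  have len: "\<nu> (Suc i) = Suc j" "Suc j \<le> \<nu> i" "\<nu> (Suc (Suc i)) \<le> j"
    using sliding_stop unfolding strip_def by (metis, metis, metis le_trans)
  have len': "length (?R (Suc i)) = Suc j" "length (?R i) = \<nu> i" "length (?R (Suc (Suc i))) \<le> j"
    using len sliding_stop.prems(2) by (simp_all add: length_fill)
  have x: "?R (Suc i) ! j = x" and right: "Suc j < length (?R i) \<longrightarrow> ?R i ! Suc j = x"
    using len sliding_stop.hyps by (auto simp: fill_def nth_append)
  let ?R' = "?R(i := (?R i)[j := ?R (Suc i) ! j])"
  have "sliding ?R' (Suc i) j (Suc i) (?R'(Suc i := butlast (?R' (Suc i))))"
    using len' by (intro sliding.sliding_stop) auto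
  then have "sliding ?R i j (Suc i) (?R'(Suc i := butlast (?R' (Suc i))))"
    using len' right x len by (intro sliding.sliding_down[of j ?R i]) auto
  moreover have "?R'(Suc i := butlast (?R' (Suc i))) = fill x (S(i := butlast (S i))) (\<nu>(Suc i := \<nu> (Suc i) - 1))"
  proof (rule ext)
    fix q
    have b: "S i = butlast (S i) @ [last (S i)]"
      using sliding_stop.hyps by (metis append_butlast_last_id list.size(3) nat.distinct(1))
    have lb: "length (butlast (S i)) = j" using sliding_stop.hyps by simp
    have "(?R i)[j := x] = butlast (S i) @ x # replicate (\<nu> i - length (S i)) x"
      unfolding fill_def by (subst b) (use lb in \<open>simp add: list_update_append\<close>)
    also have "\<dots> = butlast (S i) @ replicate (\<nu> i - length (butlast (S i))) x"
      using lb sliding_stop.hyps len by (simp flip: replicate_Suc add: Suc_diff_le Suc_diff_Suc)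
    finally have ri: "(?R i)[j := ?R (Suc i) ! j] = fill x (S(i := butlast (S i))) (\<nu>(Suc i := \<nu> (Suc i) - 1)) i"
      using x by (simp add: fill_def)
    have rs: "butlast (?R (Suc i)) = fill x S (\<nu>(Suc i := \<nu> (Suc i) - 1)) (Suc i)"
      using len sliding_stop.hyps
      by (simp add: fill_def butlast_conv_take min_def)
    show "(?R'(Suc i := butlast (?R' (Suc i)))) q = fill x (S(i := butlast (S i))) (\<nu>(Suc i := \<nu> (Suc i) - 1)) q"
      using ri rs by (auto simp: fill_def)
  qed
  ultimately show ?case by (simp del: fun_upd_apply)
qed

text \<open>Here no cell lies below the corner vacated in \<open>S\<close>, so the hole runs to the
  right through the copies of \<open>x\<close> in row \<open>k\<close>.\<close>

lemma sliding_fill_beside: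
  assumes "sliding S i j k S'" and "\<forall>a \<in> letters S. a < x" and "strip x S \<nu>"
    and "\<nu> (Suc k) \<noteq> length (S k)"
  shows "sliding (fill x S \<nu>) i j k (fill x S' (\<nu>(k := \<nu> k - 1)))"
  using assms
proof induction
  case (sliding_down j S i k S')
  let ?S = "S(i := (S i)[j := S (Suc i) ! j])"
  have e: "(fill x S \<nu>)(i := (fill x S \<nu> i)[j := fill x S \<nu> (Suc i) ! j]) = fill x ?S \<nu>"
    using sliding_down.hyps by (auto simp: fill_def nth_append list_update_append)
  have len: "\<And>q. length (?S q) = length (S q)" by simp
  have "letters ?S \<subseteq> letters S"
    using nth_mem[OF sliding_down.hyps(2)] set_update_subset_insert[of "S i" j "S (Suc i) ! j"]
    by (auto simp: letters_def split: if_splits) blast+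
  then have "sliding (fill x ?S \<nu>) (Suc i) j k (fill x S' (\<nu>(k := \<nu> k - 1)))"
    using sliding_down.prems len by (intro sliding_down.IH) (auto simp: strip_def simp del: fun_upd_apply)
  moreover have "S (Suc i) ! j < x"
    using nth_mem[OF sliding_down.hyps(2)] sliding_down.prems(1) by (auto simp: letters_def)
  ultimately show ?case
    using sliding_down.hyps(1-3) unfolding e[symmetric]
    by (intro sliding.sliding_down[of j "fill x S \<nu>" i])
      (auto simp: fill_def[of _ _ _ i] fill_def[of _ _ _ "Suc i"] nth_append simp del: fun_upd_apply)
next
  case (sliding_right j S i k S')
  let ?S = "S(i := (S i)[j := S i ! Suc j])"
  have e: "(fill x S \<nu>)(i := (fill x S \<nu> i)[j := fill x S \<nu> i ! Suc j]) = fill x ?S \<nu>"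
    using sliding_right.hyps by (auto simp: fill_def nth_append list_update_append)
  have len: "\<And>q. length (?S q) = length (S q)" by simp
  have "letters ?S \<subseteq> letters S"
    using nth_mem[OF sliding_right.hyps(1)] set_update_subset_insert[of "S i" j "S i ! Suc j"]
    by (auto simp: letters_def split: if_splits) blast+
  then have "sliding (fill x ?S \<nu>) i (Suc j) k (fill x S' (\<nu>(k := \<nu> k - 1)))"
    using sliding_right.prems len by (intro sliding_right.IH) (auto simp: strip_def simp del: fun_upd_apply)
  moreover have "S i ! Suc j < x"
    using nth_mem[OF sliding_right.hyps(1)] sliding_right.prems(1) by (auto simp: letters_def)
  ultimately show ?case
    using sliding_right.hyps(1-2) unfolding e[symmetric]
    by (intro sliding.sliding_right[of j "fill x S \<nu>" i])
      (auto simp: fill_def[of _ _ _ i] fill_def[of _ _ _ "Suc i"] nth_append simp del: fun_upd_apply)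
next
  case (sliding_stop j S i)
  let ?m = "\<nu> i - length (S i)"
  have b: "S i = butlast (S i) @ [last (S i)]"
    using sliding_stop.hyps by (metis append_butlast_last_id list.size(3) nat.distinct(1))
  have lb: "length (butlast (S i)) = j" using sliding_stop.hyps by simp
  have "fill x S \<nu> i = butlast (S i) @ last (S i) # replicate ?m x"
    unfolding fill_def by (subst b) simp
  moreover have "length (fill x S \<nu> (Suc i)) \<le> length (butlast (S i))"
    using sliding_stop unfolding length_fill[OF sliding_stop.prems(2)] strip_def
    by (metis diff_Suc_1 le_neq_implies_less length_butlast less_Suc_eq_le)
  ultimately have "sliding (fill x S \<nu>) i (length (butlast (S i))) i
      ((fill x S \<nu>)(i := butlast (S i) @ replicate ?m x))"
    by (rule sliding_right_end)
  moreover have "(fill x S \<nu>)(i := butlast (S i) @ replicate ?m x)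
      = fill x (S(i := butlast (S i))) (\<nu>(i := \<nu> i - 1))"
    using lb sliding_stop.hyps by (auto simp: fill_def)
  ultimately show ?case using lb by (simp del: fun_upd_apply)
qed

section \<open>Insertions that add a cell and cancellations that remove one\<close>

definition grow :: "letter \<Rightarrow> filling \<Rightarrow> nat \<Rightarrow> filling \<Rightarrow> bool" where
  "grow y R k R' \<longleftrightarrow> (\<exists>t. insertion 0 y R k t R')"

definition shrink :: "letter \<Rightarrow> filling \<Rightarrow> nat \<Rightarrow> filling \<Rightarrow> bool" where
  "shrink y R k R' \<longleftrightarrow> (\<exists>R1 p q. cancellation 0 y R R1 p q \<and> sliding R1 p q k R')"

lemma grow_length:
  "grow y R k R' \<Longrightarrow> length (R' q) = (if q = k then Suc (length (R q)) else length (R q))"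
  by (auto simp: grow_def dest: insertion_facts)

lemma shrink_length:
  "shrink y R k R' \<Longrightarrow> length (R' q) = (if q = k then length (R q) - 1 else length (R q))"
  by (auto simp: shrink_def dest!: cancellation_facts sliding_facts)

lemma shrink_length_pos: "shrink y R k R' \<Longrightarrow> 0 < length (R k)"
  unfolding shrink_def using cancellation_facts sliding_facts by metis

lemma grow_letters: "grow y R k R' \<Longrightarrow> letters R' \<subseteq> insert y (letters R)"
  by (auto simp: grow_def dest!: insertion_facts)

lemma shrink_letters: "shrink y R k R' \<Longrightarrow> letters R' \<subseteq> insert y (letters R)"
  unfolding shrink_def using cancellation_facts sliding_facts by (meson subset_trans)

text \<open>\<open>Barred k\<close> is the only letter strictly between \<open>Unbarred k\<close>
  and \<open>Unbarred (Suc k)\<close>. Hence cancellation is the only obstruction to bumping a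
  largest letter into the next row.\<close>

lemma letter_below_cases:
  "\<lbrakk>Unbarred k \<le> t; t < x; \<not> (t = Unbarred k \<and> x = Barred k)\<rbrakk> \<Longrightarrow> Unbarred (Suc k) \<le> x"
  by (cases t; cases x) (simp_all add: less_eq_letter_def less_letter_def, presburger+)

lemma grow_max: "\<forall>a \<in> letters R. a \<le> x \<Longrightarrow> grow x R 0 (R(0 := R 0 @ [x]))"
  unfolding grow_def by (intro exI, rule insertion_stop) (auto simp: letters_def)

lemma symplectic_length_antimono: "symplectic R \<Longrightarrow> i \<le> j \<Longrightarrow> length (R j) \<le> length (R i)"
  by (rule lift_Suc_antimono_le[of "\<lambda>i. length (R i)"]) (auto simp: symplectic_def)

section \<open>The five transitions of the strip when its core \<open>S\<close> gains or loses a
  cell\<close>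

context
  fixes x y :: letter and S S' :: filling and k :: nat and \<nu> :: "nat \<Rightarrow> nat"
  assumes S: "symplectic S" and S': "symplectic S'" and lt: "\<forall>a \<in> letters S. a < x"
    and yx: "y < x" and st: "strip x S \<nu>"
begin

lemma fill_grow_append:
  assumes g: "grow y S k S'" and k: "\<nu> k = length (S k)"
  shows "grow y (fill x S \<nu>) k (fill x S' (\<nu>(k := Suc (\<nu> k))))"
    and "strip x S' (\<nu>(k := Suc (\<nu> k)))"
proof -
  show "grow y (fill x S \<nu>) k (fill x S' (\<nu>(k := Suc (\<nu> k))))"
    using g k st lt yx insertion_fill_append unfolding grow_def strip_def by meson
  have "Suc (\<nu> k) \<le> length (S' p)" if "k = Suc p" for p
    using S' g k that unfolding symplectic_def by (metis grow_length)
  then show "strip x S' (\<nu>(k := Suc (\<nu> k)))"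
    using st k grow_length[OF g] unfolding strip_def by (auto simp: le_SucI)
qed

lemma fill_grow_bump:
  assumes g: "grow y S k S'" and k: "\<nu> k \<noteq> length (S k)" and x: "x \<noteq> Barred (Suc k)"
  shows "grow y (fill x S \<nu>) (Suc k) (fill x S' (\<nu>(Suc k := Suc (\<nu> (Suc k)))))"
    and "strip x S' (\<nu>(Suc k := Suc (\<nu> (Suc k))))"
proof -
  from g obtain t where t: "insertion 0 y S k t S'" by (auto simp: grow_def)
  have less: "length (S k) < \<nu> k" using st k by (metis le_neq_implies_less strip_def)
  show "grow y (fill x S \<nu>) (Suc k) (fill x S' (\<nu>(Suc k := Suc (\<nu> (Suc k)))))"
    using t less st lt yx x by (auto simp: grow_def strip_def intro!: exI insertion_fill_bump)
  have "S' k = S k @ [t]" "t \<in> insert y (letters S)" using insertion_facts[OF t] by auto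
  then have "Unbarred (Suc k) \<le> t" "t < x" using S' lt yx by (auto simp: symplectic_def)
  then have "Unbarred (Suc (Suc k)) \<le> x" using x by (auto intro: letter_below_cases)
  then show "strip x S' (\<nu>(Suc k := Suc (\<nu> (Suc k))))"
    using st less grow_length[OF g] unfolding strip_def by (auto simp: le_SucI)
qed

text \<open>The letter appended to row \<open>k\<close> of the symplectic \<open>S'\<close> is at
  least \<open>Unbarred (Suc k)\<close> and below \<open>Barred (Suc k)\<close>. It is therefore
  forced, and meeting an \<open>x = Barred (Suc k)\<close> in this row always means
  cancellation.\<close>

lemma fill_cancel:
  assumes g: "grow y S k S'" and k: "\<nu> k \<noteq> length (S k)" and x: "x = Barred (Suc k)"
  shows "shrink y (fill x S \<nu>) k (fill x (S'(k := S k)) (\<nu>(k := \<nu> k - 1)))"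
    and "strip x (S'(k := S k)) (\<nu>(k := \<nu> k - 1))"
    and "symplectic (S'(k := S k))"
    and "S' k = S k @ [Unbarred (Suc k)]"
proof -
  from g obtain t where t: "insertion 0 y S k t S'" by (auto simp: grow_def)
  have less: "length (S k) < \<nu> k" using st k by (metis le_neq_implies_less strip_def)
  have S'k: "S' k = S k @ [t]" and "t \<in> insert y (letters S)" using insertion_facts[OF t] by auto
  then have "Unbarred (Suc k) \<le> t" "t < x" using S' lt yx by (auto simp: symplectic_def)
  then have tk: "t = Unbarred (Suc k)" using x
    by (cases t) (auto simp: less_eq_letter_def less_letter_def, presburger)
  then show "S' k = S k @ [Unbarred (Suc k)]" using S'k by simp
  let ?S = "S'(k := S k)"
  have len: "length (?S q) = length (S q)" for q using grow_length[OF g] by simp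
  have c: "cancellation 0 y (fill x S \<nu>) (fill x ?S \<nu>) k (length (S k))"
    using cancellation_fill_new[where \<nu> = \<nu>, OF t lt yx less tk x] .
  let ?m = "\<nu> k - Suc (length (S k))"
  have row: "fill x ?S \<nu> k = S k @ x # replicate ?m x"
    using less by (simp add: fill_def flip: replicate_Suc Suc_diff_Suc)
  have "length (fill x ?S \<nu> (Suc k)) \<le> length (S k)"
    using st len[of "Suc k"] by (simp add: fill_def strip_def)
  from sliding_right_end[of "fill x ?S \<nu>", OF row this]
  have "sliding (fill x ?S \<nu>) k (length (S k)) k ((fill x ?S \<nu>)(k := S k @ replicate ?m x))" .
  moreover have "(fill x ?S \<nu>)(k := S k @ replicate ?m x) = fill x ?S (\<nu>(k := \<nu> k - 1))"
    by (auto simp: fill_def)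
  ultimately show "shrink y (fill x S \<nu>) k (fill x ?S (\<nu>(k := \<nu> k - 1)))"
    using c unfolding shrink_def by auto
  show "strip x ?S (\<nu>(k := \<nu> k - 1))"
    using st less unfolding strip_def len by (auto intro: le_trans[OF diff_le_self])
  show "symplectic ?S"
    unfolding symplectic_def
  proof (intro conjI allI impI ballI)
    fix i j
    show "sorted (?S i)" using S S' by (simp add: symplectic_def)
    show "length (?S (Suc i)) \<le> length (?S i)" using S unfolding len by (simp add: symplectic_def)
    show "Unbarred (Suc i) \<le> a" if "a \<in> set (?S i)" for a
      using S S' that by (auto simp: symplectic_def split: if_splits)
    \<comment> \<open>Row \<open>k\<close> of \<open>S\<close> is row \<open>k\<close> of
      \<open>S'\<close> without its last letter, so all column comparisons can be read off from
      \<open>S'\<close>.\<close>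
    assume j: "j < length (?S (Suc i))"
    then have "j < length (S i)" using S unfolding len symplectic_def by (meson less_le_trans)
    then have "?S i ! j = S' i ! j" using S'k by (cases "i = k") (auto simp: nth_append)
    moreover have "?S (Suc i) ! j = S' (Suc i) ! j" "j < length (S' (Suc i))"
      using S'k j by (auto simp: nth_append split: if_splits)
    ultimately show "?S i ! j < ?S (Suc i) ! j" using S' by (simp add: symplectic_def)
  qed
qed

lemma fill_shrink_below:
  assumes g: "shrink y S k S'" and k: "\<nu> (Suc k) = length (S k)"
  shows "shrink y (fill x S \<nu>) (Suc k) (fill x S' (\<nu>(Suc k := \<nu> (Suc k) - 1)))"
    and "strip x S' (\<nu>(Suc k := \<nu> (Suc k) - 1))"
proof -
  from g obtain S1 p q where c: "cancellation 0 y S S1 p q" and s: "sliding S1 p q k S'"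
    by (auto simp: shrink_def)
  have f: "\<And>r. length (S1 r) = length (S r)" "letters S1 \<subseteq> insert y (letters S)"
    using cancellation_facts[OF c] by auto
  have "sliding (fill x S1 \<nu>) p q (Suc k) (fill x S' (\<nu>(Suc k := \<nu> (Suc k) - 1)))"
    using s f lt yx st k by (intro sliding_fill_below) (auto simp: strip_def)
  then show "shrink y (fill x S \<nu>) (Suc k) (fill x S' (\<nu>(Suc k := \<nu> (Suc k) - 1)))"
    unfolding shrink_def using cancellation_fill[OF c] by blast
  have "length (S' (Suc k)) \<le> length (S' k)" using S' by (simp add: symplectic_def)
  then have "length (S (Suc k)) \<le> length (S k) - 1" using shrink_length[OF g] by simp
  \<comment> \<open>The cell of row \<open>k\<close> vacated by \<open>S\<close> now carries an
    \<open>x\<close>. The symplectic bound for it comes from the smaller letters already in this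
    row.\<close>
  moreover have "S k ! 0 \<in> set (S k)" using shrink_length_pos[OF g] by simp
  then have "Unbarred (Suc k) \<le> S k ! 0" "S k ! 0 < x" using S lt by (auto simp: symplectic_def letters_def)
  then have "Unbarred (Suc k) \<le> x" by simp
  ultimately show "strip x S' (\<nu>(Suc k := \<nu> (Suc k) - 1))"
    using st shrink_length_pos[OF g] k unfolding strip_def shrink_length[OF g]
    by (auto intro: le_trans[OF diff_le_self] le_trans[OF _ diff_le_self])
qed

lemma fill_shrink_beside:
  assumes g: "shrink y S k S'" and k: "\<nu> (Suc k) \<noteq> length (S k)"
  shows "shrink y (fill x S \<nu>) k (fill x S' (\<nu>(k := \<nu> k - 1)))"
    and "strip x S' (\<nu>(k := \<nu> k - 1))"
proof -
  from g obtain S1 p q where c: "cancellation 0 y S S1 p q" and s: "sliding S1 p q k S'"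
    by (auto simp: shrink_def)
  have f: "\<And>r. length (S1 r) = length (S r)" "letters S1 \<subseteq> insert y (letters S)"
    using cancellation_facts[OF c] by auto
  have "sliding (fill x S1 \<nu>) p q k (fill x S' (\<nu>(k := \<nu> k - 1)))"
    using s f lt yx st k by (intro sliding_fill_beside) (auto simp: strip_def)
  then show "shrink y (fill x S \<nu>) k (fill x S' (\<nu>(k := \<nu> k - 1)))"
    unfolding shrink_def using cancellation_fill[OF c] by blast
  have "\<nu> (Suc k) < length (S k)" using st k by (metis le_neq_implies_less strip_def)
  then show "strip x S' (\<nu>(k := \<nu> k - 1))"
    using st shrink_length_pos[OF g] unfolding strip_def shrink_length[OF g]
    by (auto intro: le_trans[OF diff_le_self] diff_le_mono)
qed

end

section \<open>Existence of symplectic outcomes\<close>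

definition berele_step :: "letter \<Rightarrow> filling \<Rightarrow> filling \<Rightarrow> bool" where
  "berele_step y R R' \<longleftrightarrow> symplectic R' \<and> (\<exists>k. grow y R k R' \<or> shrink y R k R')"

lemma berele_step_letters: "berele_step y R R' \<Longrightarrow> letters R' \<subseteq> insert y (letters R)"
  unfolding berele_step_def using grow_letters shrink_letters by meson

lemma berele_step_max:
  assumes R: "symplectic R" and le: "\<forall>a \<in> letters R. a \<le> x" and x: "Unbarred (Suc 0) \<le> x"
  shows "berele_step x R (R(0 := R 0 @ [x]))"
proof -
  have "symplectic (R(0 := R 0 @ [x]))"
    using R le x symplectic_length_antimono[OF R, of 0]
    by (auto simp: symplectic_def sorted_append letters_def nth_append le_SucI
        dest: less_le_trans split: if_splits)
  then show ?thesis using grow_max[OF le] by (auto simp: berele_step_def)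
qed

text \<open>The induction is on a bound for the ranks, which need not be attained; the strip of
  letters of top rank may be empty. The base case is vacuous because the least admissible
  \<open>y\<close> has rank 2. In the cancellation case the new core is not \<open>S'\<close> but
  \<open>S'\<close> with row \<open>k\<close> restored.\<close>

lemma berele_step_exists:
  assumes "symplectic R" and "\<forall>a \<in> letters R. letter_rank a \<le> N" and "letter_rank y \<le> N"
    and "Unbarred (Suc 0) \<le> y"
  shows "\<exists>R'. berele_step y R R'"
  using assms
proof (induction N arbitrary: R)
  case 0
  then show ?case by (simp add: less_eq_letter_def)
next
  case (Suc N)
  show ?case
  proof (cases "letter_rank y = Suc N")
    case True
    with Suc.prems have "\<forall>a \<in> letters R. a \<le> y" by (auto simp: less_eq_letter_def)
    then show ?thesis using berele_step_max[of R y] Suc.prems by blast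
  next
    case False
    \<comment> \<open>Even ranks belong to unbarred letters and odd ranks to barred ones;
      \<open>x\<close> need not occur in \<open>R\<close>.\<close>
    obtain x where x: "letter_rank x = Suc N"
    proof (cases "even (Suc N)")
      case True
      then show ?thesis using that[of "Unbarred (Suc N div 2)"] by simp
    next
      case False
      then show ?thesis using that[of "Barred (Suc N div 2)"] odd_two_times_div_two_succ by simp
    qed
    with Suc.prems False have yx: "y < x" and le: "\<forall>a \<in> letters R. a \<le> x"
      by (auto simp: less_eq_letter_def less_letter_def)
    let ?S = "restrict_below x R" and ?\<nu> = "\<lambda>i. length (R i)"
    note R = fill_restrict_below[OF Suc.prems(1) le]
    have "\<forall>a \<in> letters ?S. letter_rank a \<le> N" using R(4) x by (auto simp: less_letter_def)
    from Suc.IH[OF R(3) this _ Suc.prems(4)] Suc.prems(3) False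
    obtain S' where "berele_step y ?S S'" by auto
    then obtain k where S': "symplectic S'" and gs: "grow y ?S k S' \<or> shrink y ?S k S'"
      by (auto simp: berele_step_def)
    have lt': "\<forall>a \<in> letters S'. a < x"
      using gs grow_letters shrink_letters R(4) yx by blast
    note facts = R(3) S' R(4) yx R(2)
    have *: "berele_step y R (fill x T \<mu>)"
      if "symplectic T" "\<forall>a \<in> letters T. a < x" "strip x T \<mu>"
        "(\<exists>k. grow y (fill x ?S ?\<nu>) k (fill x T \<mu>) \<or> shrink y (fill x ?S ?\<nu>) k (fill x T \<mu>))" for T \<mu>
      using that symplectic_fill[OF that(1-3)] by (auto simp: R(1) berele_step_def)
    from gs show ?thesis
    proof
      assume g: "grow y ?S k S'"
      show ?thesis
      proof (cases "?\<nu> k = length (?S k)")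
        case True
        then show ?thesis using *[OF S' lt'] fill_grow_append[OF facts g] by blast
      next
        case nk: False
        show ?thesis
        proof (cases "x = Barred (Suc k)")
          case True
          have "letters (S'(k := ?S k)) \<subseteq> letters S' \<union> letters ?S"
            by (auto simp: letters_def split: if_splits)
          then have "\<forall>a \<in> letters (S'(k := ?S k)). a < x" using lt' R(4) by blast
          then show ?thesis using * fill_cancel[OF facts g nk True] by blast
        next
          case False
          then show ?thesis using *[OF S' lt'] fill_grow_bump[OF facts g nk] by blast
        qed
      qed
    next
      assume g: "shrink y ?S k S'"
      then show ?thesis
        using *[OF S' lt'] fill_shrink_below[OF facts g] fill_shrink_beside[OF facts g] by blast
    qed
  qed
qed

section \<open>Insertion of tableaux stored as lists of rows\<close>

definition row :: "tableau \<Rightarrow> filling" where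
  "row T i = (if i < length T then T ! i else [])"

text \<open>\<open>row\<close> does not see trailing empty rows, so it determines a tableau only if
  there are no empty rows.\<close>

definition proper :: "tableau \<Rightarrow> bool" where
  "proper T \<longleftrightarrow> [] \<notin> set T"

lemma row_Nil [simp]: "row [] i = []"
  and row_Cons_0 [simp]: "row (r # rs) 0 = r"
  and row_Cons_Suc [simp]: "row (r # rs) (Suc i) = row rs i"
  by (auto simp: row_def)

lemma proper_simps [simp]: "proper []" "proper (r # rs) \<longleftrightarrow> r \<noteq> [] \<and> proper rs"
  by (auto simp: proper_def)

lemma proper_row_iff: "proper T \<Longrightarrow> row T i \<noteq> [] \<longleftrightarrow> i < length T"
  by (auto simp: proper_def row_def dest: nth_mem)

lemma in_shape_row: "in_shape T i j \<longleftrightarrow> j < length (row T i)"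
  by (auto simp: in_shape_def row_def)

lemma proper_row_inject:
  assumes "proper T" and "proper T'" and "row T = row T'"
  shows "T = T'"
proof -
  have i: "i < length T \<longleftrightarrow> i < length T'" for i
    using assms proper_row_iff by metis
  then have "length T = length T'" by (meson linorder_neqE_nat less_irrefl)
  moreover have "T ! i = T' ! i" if "i < length T" for i
    using assms(3) that i by (metis row_def)
  ultimately show ?thesis by (rule nth_equalityI)
qed

lemma bump_pos_end: "\<forall>a \<in> set r. a \<le> y \<Longrightarrow> bump_pos y r = length r"
  unfolding bump_pos_def by (subst takeWhile_eq_all_conv[THEN iffD2]) auto

lemma bump_pos_mid: "\<forall>a \<in> set u. a \<le> y \<Longrightarrow> y < z \<Longrightarrow> bump_pos y (u @ z # v) = length u"
  unfolding bump_pos_def by (subst takeWhile_append2) auto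

text \<open>\<open>T\<close> holds the rows of \<open>R\<close> from \<open>i\<close> on, because
  the functions recurse on the remaining rows and \<open>cancel_stage\<close> carries the offset
  \<open>i\<close>.\<close>

lemma row_insert_insertion:
  assumes "insertion i y R k t R'" and "\<forall>q. row T q = R (q + i)" and "proper T"
  shows "proper (row_insert y T) \<and> (\<forall>q. row (row_insert y T) q = R' (q + i)) \<and>
    cancel_stage i y T = None"
  using assms
proof (induction arbitrary: T)
  case (insertion_stop R i y)
  show ?case
  proof (cases T)
    case Nil
    have "row [[y]] q = (R(i := R i @ [y])) (q + i)" for q
      using insertion_stop.prems(1)[rule_format, of q] Nil by (cases q) auto
    then show ?thesis using Nil by simp
  next
    case (Cons r rs)
    have "r = R i" using insertion_stop.prems(1)[rule_format, of 0] Cons by simp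
    moreover have "row ((r @ [y]) # rs) q = (R(i := R i @ [y])) (q + i)" for q
      using insertion_stop.prems(1)[rule_format, of q] Cons \<open>r = R i\<close> by (cases q) auto
    ultimately show ?thesis
      using insertion_stop Cons bump_pos_end[of r y] by simp
  qed
next
  case (insertion_bump R i u z v y k t R')
  obtain r rs where T: "T = r # rs"
    using insertion_bump.hyps(1) insertion_bump.prems(1)[rule_format, of 0] by (cases T) auto
  have r: "r = u @ z # v"
    using insertion_bump.hyps(1) insertion_bump.prems(1)[rule_format, of 0] T by simp
  have "row rs q = R (q + Suc i)" for q
    using insertion_bump.prems(1)[rule_format, of "Suc q"] T by simp
  then have IH: "proper (row_insert z rs) \<and> (\<forall>q. row (row_insert z rs) q = R' (q + Suc i)) \<and>
      cancel_stage (Suc i) z rs = None"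
    using insertion_bump.IH insertion_bump.prems(2) T by simp
  have "row ((u @ y # v) # row_insert z rs) q = (R'(i := u @ y # v)) (q + i)" for q
    using IH by (cases q) auto
  then show ?case
    using T r IH bump_pos_mid[OF insertion_bump.hyps(2,3), of v] insertion_bump.hyps(4)
    by (simp add: Let_def)
qed

lemma row_insert_row_0: "z \<in> set (row (row_insert z T) 0)"
proof (cases T)
  case (Cons r rs)
  then show ?thesis by (auto simp: Let_def set_update_memI)
qed simp

lemma cancel_stage_cancellation:
  assumes "cancellation i y R R' p q" and "\<forall>r. row T r = R (r + i)" and "proper T"
  shows "\<exists>T'. cancel_stage i y T = Some (T', p, q) \<and> proper T' \<and> (\<forall>r. row T' r = R' (r + i))"
  using assms
proof (induction arbitrary: T)
  case (cancellation_here R i u v)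
  obtain r rs where T: "T = r # rs"
    using cancellation_here.hyps(1) cancellation_here.prems(1)[rule_format, of 0] by (cases T) auto
  have r: "r = u @ Barred (Suc i) # v"
    using cancellation_here.hyps(1) cancellation_here.prems(1)[rule_format, of 0] T by simp
  have "Unbarred (Suc i) < Barred (Suc i)" by (simp add: less_letter_def)
  then show ?case
    using T r cancellation_here bump_pos_mid[OF cancellation_here.hyps(2), of "Barred (Suc i)" v]
    by (simp add: Let_def)
next
  case (cancellation_bump R i u z v y R' p q)
  obtain r rs where T: "T = r # rs"
    using cancellation_bump.hyps(1) cancellation_bump.prems(1)[rule_format, of 0] by (cases T) auto
  have r: "r = u @ z # v"
    using cancellation_bump.hyps(1) cancellation_bump.prems(1)[rule_format, of 0] T by simp
  have "row rs q = R (q + Suc i)" for q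
    using cancellation_bump.prems(1)[rule_format, of "Suc q"] T by simp
  then obtain T' where T': "cancel_stage (Suc i) z rs = Some (T', p, q)" "proper T'"
      "\<forall>r. row T' r = R' (r + Suc i)"
    using cancellation_bump.IH[of rs] cancellation_bump.prems(2) T by auto
  have "row ((u @ y # v) # T') r = (R'(i := u @ y # v)) (r + i)" for r
    using T' by (cases r) auto
  moreover have "cancel_stage i y T = Some ((u @ y # v) # T', p, q)"
    using T r T' bump_pos_mid[OF cancellation_bump.hyps(2,3), of v] cancellation_bump.hyps(4)
    by (simp add: Let_def del: de_Morgan_conj)
  ultimately show ?case using T' by (intro exI[of _ "(u @ y # v) # T'"]) simp
qed

text \<open>Ordinary row insertion would push the bumped barred letter into the next row, where it
  violates the symplectic bound. This sends \<open>berele_insert\<close> into its second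
  branch.\<close>

lemma row_insert_cancellation:
  assumes "cancellation i y R R' p q" and "\<forall>r. row T r = R (r + i)"
  shows "\<exists>r. \<exists>a \<in> set (row (row_insert y T) r). \<not> Unbarred (Suc (r + i)) \<le> a"
  using assms
proof (induction arbitrary: T)
  case (cancellation_here R i u v)
  obtain r rs where T: "T = r # rs"
    using cancellation_here.hyps(1) cancellation_here.prems(1)[rule_format, of 0] by (cases T) auto
  have r: "r = u @ Barred (Suc i) # v"
    using cancellation_here.hyps(1) cancellation_here.prems(1)[rule_format, of 0] T by simp
  have "Unbarred (Suc i) < Barred (Suc i)" by (simp add: less_letter_def)
  then have "row (row_insert (Unbarred (Suc i)) T) 1 = row (row_insert (Barred (Suc i)) rs) 0"
    using T r bump_pos_mid[OF cancellation_here.hyps(2), of "Barred (Suc i)" v]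
    by (simp add: Let_def)
  then have "Barred (Suc i) \<in> set (row (row_insert (Unbarred (Suc i)) T) 1)"
    using row_insert_row_0 by simp
  then show ?case by (intro exI[of _ 1] bexI) (auto simp: less_eq_letter_def)
next
  case (cancellation_bump R i u z v y R' p q)
  obtain r rs where T: "T = r # rs"
    using cancellation_bump.hyps(1) cancellation_bump.prems(1)[rule_format, of 0] by (cases T) auto
  have r: "r = u @ z # v"
    using cancellation_bump.hyps(1) cancellation_bump.prems(1)[rule_format, of 0] T by simp
  have "row rs q = R (q + Suc i)" for q
    using cancellation_bump.prems(1)[rule_format, of "Suc q"] T by simp
  then obtain s a where "a \<in> set (row (row_insert z rs) s)" "\<not> Unbarred (Suc (s + Suc i)) \<le> a"
    using cancellation_bump.IH[of rs] by auto
  moreover have "row (row_insert y T) (Suc s) = row (row_insert z rs) s"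
    using T r bump_pos_mid[OF cancellation_bump.hyps(2,3), of v] by (simp add: Let_def)
  ultimately show ?case by (intro exI[of _ "Suc s"]) auto
qed

lemma row_update: "i < length T \<Longrightarrow> row (T[i := r]) = (row T)(i := r)"
  by (auto simp: row_def)

lemma proper_update: "proper T \<Longrightarrow> r \<noteq> [] \<Longrightarrow> proper (T[i := r])"
  using set_update_subset_insert by (fastforce simp: proper_def)

text \<open>Dropping an emptied row is harmless only for the last row; further up it would shift the
  rows below.\<close>

lemma row_filter_update:
  assumes T: "proper T" and i: "i < length T" and r: "r \<noteq> [] \<or> Suc i = length T"
  shows "proper (filter (\<lambda>r. r \<noteq> []) (T[i := r])) \<and>
    row (filter (\<lambda>r. r \<noteq> []) (T[i := r])) = (row T)(i := r)"
proof (cases "r = []")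
  case False
  then have "filter (\<lambda>r. r \<noteq> []) (T[i := r]) = T[i := r]"
    using proper_update[OF T False] by (auto simp: proper_def filter_id_conv)
  then show ?thesis using proper_update[OF T False] row_update[OF i] by simp
next
  case True
  with r have len: "length T = Suc i" by simp
  then have "T \<noteq> []" by auto
  then have T': "T = butlast T @ [last T]" by simp
  have f: "filter (\<lambda>r. r \<noteq> []) (butlast T) = butlast T"
    using T by (auto simp: proper_def filter_id_conv dest: in_set_butlastD)
  have "T[i := []] = butlast T @ [[]]"
    using len by (subst T') (simp add: list_update_append)
  then have "filter (\<lambda>r. r \<noteq> []) (T[i := r]) = butlast T" using True f by simp
  moreover have "row (butlast T) = (row T)(i := [])"
    using len by (auto simp: row_def nth_butlast fun_eq_iff)
  moreover have "proper (butlast T)" using T by (auto simp: proper_def dest: in_set_butlastD)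
  ultimately show ?thesis using True by simp
qed

lemma slide_sliding:
  assumes "sliding R i j k R'" and "row T = R" and "proper T"
  shows "proper (slide T i j) \<and> row (slide T i j) = R'"
  using assms
proof (induction arbitrary: T)
  case (sliding_down j R i k R')
  have i: "i < length T" "Suc i < length T"
    using sliding_down.hyps(1,2) sliding_down.prems(1) by (auto simp: row_def split: if_splits)
  let ?T = "T[i := (T ! i)[j := T ! Suc i ! j]]"
  have n: "T ! i = R i" "T ! Suc i = R (Suc i)" using i sliding_down.prems(1) by (auto simp: row_def)
  have "slide T i j = slide ?T (Suc i) j"
    using sliding_down.hyps sliding_down.prems n by (subst slide.simps) (simp add: in_shape_row)
  moreover have "row ?T = R(i := (R i)[j := R (Suc i) ! j])"
    using row_update[OF i(1)] n sliding_down.prems(1) by simp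
  moreover have "proper ?T" using sliding_down.hyps(1) n
    by (intro proper_update sliding_down.prems(2)) auto
  ultimately show ?case using sliding_down.IH by metis
next
  case (sliding_right j R i k R')
  have i: "i < length T"
    using sliding_right.hyps(1) sliding_right.prems(1) by (auto simp: row_def split: if_splits)
  let ?T = "T[i := (T ! i)[j := T ! i ! Suc j]]"
  have n: "T ! i = R i" using i sliding_right.prems(1) by (auto simp: row_def)
  have n': "T ! Suc i = R (Suc i)" if "j < length (R (Suc i))"
    using that sliding_right.prems(1) by (auto simp: row_def split: if_splits)
  have "slide T i j = slide ?T i (Suc j)"
    using sliding_right.hyps sliding_right.prems n n'
    by (subst slide.simps) (auto simp: in_shape_row)
  moreover have "row ?T = R(i := (R i)[j := R i ! Suc j])"
    using row_update[OF i(1)] n sliding_right.prems(1) by simp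
  moreover have "proper ?T" using sliding_right.hyps(1) n
    by (intro proper_update sliding_right.prems(2)) auto
  ultimately show ?case using sliding_right.IH by metis
next
  case (sliding_stop j R i)
  have i: "i < length T"
    using sliding_stop.hyps(1) sliding_stop.prems(1) by (auto simp: row_def split: if_splits)
  have n: "T ! i = R i" using i sliding_stop.prems(1) by (auto simp: row_def)
  have "slide T i j = remove_cell i j T"
    using sliding_stop by (subst slide.simps) (simp add: in_shape_row)
  also have "\<dots> = filter (\<lambda>r. r \<noteq> []) (T[i := butlast (R i)])"
    using sliding_stop.hyps(1) n by (simp add: remove_cell_def butlast_conv_take flip: sliding_stop.hyps(1))
  finally have s: "slide T i j = filter (\<lambda>r. r \<noteq> []) (T[i := butlast (R i)])" .
  have "butlast (R i) \<noteq> [] \<or> Suc i = length T"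
  proof (cases "j = 0")
    case True
    then have "row T (Suc i) = []" using sliding_stop by simp
    then have "\<not> Suc i < length T" using proper_row_iff[OF sliding_stop.prems(2)] by blast
    then show ?thesis using i by simp
  next
    case False
    then have "length (butlast (R i)) \<noteq> 0" using sliding_stop.hyps(1) by simp
    then show ?thesis by (metis list.size(3))
  qed
  from row_filter_update[OF sliding_stop.prems(2) i this] s sliding_stop.prems(1)
  show ?case by simp
qed

lemma entries_row: "entries T = letters (row T)"
proof -
  have "a \<in> entries T \<longleftrightarrow> (\<exists>i < length T. a \<in> set (T ! i))" for a
    unfolding entries_def by (metis UN_iff in_set_conv_nth)
  moreover have "a \<in> letters (row T) \<longleftrightarrow> (\<exists>i < length T. a \<in> set (T ! i))" for a
    by (auto simp: letters_def row_def split: if_splits)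
  ultimately show ?thesis by blast
qed

lemma sp_tableau_row:
  "sp_tableau n T \<longleftrightarrow> proper T \<and> symplectic (row T) \<and> letters (row T) \<subseteq> Gamma n"
proof -
  have nth: "row T i ! j = T ! i ! j" if "j < length (row T i)" for i j
    using that by (auto simp: row_def split: if_splits)
  have part: "is_partition (shape T) \<longleftrightarrow> proper T \<and> (\<forall>i. length (row T (Suc i)) \<le> length (row T i))"
  proof -
    have "transp ((\<ge>) :: nat \<Rightarrow> nat \<Rightarrow> bool)" by (auto simp: transp_def)
    then have "sorted_wrt (\<ge>) (shape T) \<longleftrightarrow> (\<forall>i. Suc i < length T \<longrightarrow> length (T ! Suc i) \<le> length (T ! i))"
      by (subst sorted_wrt_iff_nth_Suc_transp) (auto simp: shape_def)
    also have "\<dots> \<longleftrightarrow> (\<forall>i. length (row T (Suc i)) \<le> length (row T i))"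
      by (auto simp: row_def)
    finally show ?thesis by (auto simp: is_partition_def shape_def proper_def)
  qed
  have sorted: "(\<forall>r \<in> set T. sorted r) \<longleftrightarrow> (\<forall>i. sorted (row T i))"
    by (auto simp: row_def all_set_conv_all_nth)
  have ge: "(\<forall>i j. in_shape T i j \<longrightarrow> Unbarred (Suc i) \<le> T ! i ! j) \<longleftrightarrow>
      (\<forall>i. \<forall>a \<in> set (row T i). Unbarred (Suc i) \<le> a)"
    unfolding in_shape_row all_set_conv_all_nth using nth by simp
  have col: "(\<forall>i j. in_shape T (Suc i) j \<longrightarrow> T ! i ! j < T ! Suc i ! j) \<longleftrightarrow>
      (\<forall>i j. j < length (row T (Suc i)) \<longrightarrow> row T i ! j < row T (Suc i) ! j)"
    if "\<forall>i. length (row T (Suc i)) \<le> length (row T i)"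
  proof -
    have "j < length (row T i)" if "j < length (row T (Suc i))" for i j
      using \<open>\<forall>i. length (row T (Suc i)) \<le> length (row T i)\<close> that by (meson less_le_trans)
    then show ?thesis unfolding in_shape_row using nth by simp
  qed
  show ?thesis
    unfolding sp_tableau_def symplectic_def part sorted ge entries_row using col by blast
qed

text \<open>Since \<open>berele_insert\<close> is a function, \<open>R'\<close> is determined by
  \<open>T\<close> and \<open>y\<close>. Any step constructed by hand therefore identifies the next
  \<open>P\<close>-symbol.\<close>

lemma berele_insert_step:
  assumes T: "sp_tableau n T" and y: "y \<in> Gamma n" and st: "berele_step y (row T) R'"
  shows "row (berele_insert n T y) = R' \<and> sp_tableau n (berele_insert n T y)"
proof -
  have p: "proper T" and l: "letters (row T) \<subseteq> Gamma n" using T by (auto simp: sp_tableau_row)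
  have sy: "symplectic R'" and l': "letters R' \<subseteq> Gamma n"
    using st berele_step_letters[OF st] y l by (auto simp: berele_step_def)
  from st obtain k where "grow y (row T) k R' \<or> shrink y (row T) k R'" by (auto simp: berele_step_def)
  then show ?thesis
  proof
    assume "grow y (row T) k R'"
    then obtain t where "insertion 0 y (row T) k t R'" by (auto simp: grow_def)
    from row_insert_insertion[OF this _ p]
    have r: "proper (row_insert y T)" "row (row_insert y T) = R'" by (auto simp: fun_eq_iff)
    then have "sp_tableau n (row_insert y T)" using sy l' by (simp add: sp_tableau_row)
    then show ?thesis using r by (simp add: berele_insert_def)
  next
    assume "shrink y (row T) k R'"
    then obtain R1 p' q where c: "cancellation 0 y (row T) R1 p' q" and s: "sliding R1 p' q k R'"
      by (auto simp: shrink_def)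
    from cancel_stage_cancellation[OF c _ p] obtain T' where
      T': "cancel_stage 0 y T = Some (T', p', q)" "proper T'" "row T' = R1"
      by (auto simp: fun_eq_iff)
    have "\<not> sp_tableau n (row_insert y T)"
      using row_insert_cancellation[OF c] by (auto simp: sp_tableau_row symplectic_def)
    then have "berele_insert n T y = slide T' p' q" using T' by (simp add: berele_insert_def)
    then show ?thesis
      using slide_sliding[OF s T'(3,2)] sy l' by (simp add: sp_tableau_row)
  qed
qed

section \<open>\<open>P\<close>-symbols of words over \<open>Gamma n\<close>\<close>

lemma Gamma_ge: "y \<in> Gamma n \<Longrightarrow> Unbarred (Suc 0) \<le> y"
  by (cases y) (auto simp: Gamma_def less_eq_letter_def)

lemma Gamma_rank: "y \<in> Gamma n \<Longrightarrow> letter_rank y \<le> 2 * n + 1"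
  by (cases y) (auto simp: Gamma_def)

lemma berele_P_snoc: "berele_P n (w @ [y]) = berele_insert n (berele_P n w) y"
  by (simp add: berele_P_def)

lemma sp_tableau_step_exists:
  assumes "sp_tableau n T" and "y \<in> Gamma n"
  shows "\<exists>R'. berele_step y (row T) R'"
proof (rule berele_step_exists)
  show "\<forall>a \<in> letters (row T). letter_rank a \<le> 2 * n + 1"
    using assms(1) Gamma_rank by (meson sp_tableau_row subsetD)
qed (use assms Gamma_rank Gamma_ge in \<open>auto simp: sp_tableau_row\<close>)

lemma sp_tableau_berele_P: "set w \<subseteq> Gamma n \<Longrightarrow> sp_tableau n (berele_P n w)"
proof (induction w rule: rev_induct)
  case Nil
  then show ?case by (simp add: berele_P_def sp_tableau_row symplectic_def letters_def)
next
  case (snoc y w)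
  then have T: "sp_tableau n (berele_P n w)" and y: "y \<in> Gamma n" by auto
  then obtain R' where "berele_step y (row (berele_P n w)) R'"
    using sp_tableau_step_exists by blast
  then show ?case using berele_insert_step[OF T y] by (simp add: berele_P_snoc)
qed

lemma row_berele_P_snoc:
  assumes "set w \<subseteq> Gamma n" and "y \<in> Gamma n" and "berele_step y (row (berele_P n w)) R'"
  shows "row (berele_P n (w @ [y])) = R'"
  using assms berele_insert_step sp_tableau_berele_P by (simp add: berele_P_snoc)

lemma berele_step_berele_P:
  assumes "set w \<subseteq> Gamma n" and "y \<in> Gamma n"
  shows "berele_step y (row (berele_P n w)) (row (berele_P n (w @ [y])))"
proof -
  obtain R' where "berele_step y (row (berele_P n w)) R'"
    using sp_tableau_step_exists[OF sp_tableau_berele_P] assms by blast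
  then show ?thesis using row_berele_P_snoc[OF assms] by simp
qed

section \<open>Deleting a largest letter along an insertion\<close>

abbreviation (input) lengths :: "filling \<Rightarrow> nat \<Rightarrow> nat" where
  "lengths R \<equiv> (\<lambda>i. length (R i))"

text \<open>\<open>R'\<close> is \<open>R\<close> without its rightmost \<open>x\<close>, the one in row \<open>c\<close>: the rows above \<open>c\<close> contain no \<open>x\<close>.\<close>

definition marked :: "letter \<Rightarrow> filling \<Rightarrow> filling \<Rightarrow> nat \<Rightarrow> bool" where
  "marked x R R' c \<longleftrightarrow> (\<exists>S \<nu>. symplectic S \<and> (\<forall>a \<in> letters S. a < x) \<and>
     strip x S \<nu> \<and> strip x S (\<nu>(c := Suc (\<nu> c))) \<and> (\<forall>i < c. \<nu> i = length (S i)) \<and>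
     R = fill x S (\<nu>(c := Suc (\<nu> c))) \<and> R' = fill x S \<nu>)"

text \<open>The condition on the rows \<open>i \<ge> c\<close> says that all columns left of the additional cell in row \<open>c\<close> already
  contain \<open>x\<close>, so that \<open>R'\<close> arises from \<open>R\<close> in the same way as \<open>Pbar\<close> from \<open>P\<close>.\<close>

definition supplemented :: "letter \<Rightarrow> filling \<Rightarrow> filling \<Rightarrow> nat \<Rightarrow> bool" where
  "supplemented x R R' c \<longleftrightarrow> (\<exists>S \<nu>. symplectic S \<and> (\<forall>a \<in> letters S. a < x) \<and>
     strip x S \<nu> \<and> strip x S (\<nu>(c := Suc (\<nu> c))) \<and> (\<forall>i \<ge> c. \<nu> (Suc i) = length (S i)) \<and>
     R = fill x S \<nu> \<and> R' = fill x S (\<nu>(c := Suc (\<nu> c))))"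

text \<open>The disjuncts are the cases (J), (J bar), (W), (Ya) of the local rules, in this order.\<close>

definition square :: "(nat \<Rightarrow> nat) \<Rightarrow> (nat \<Rightarrow> nat) \<Rightarrow> (nat \<Rightarrow> nat) \<Rightarrow> (nat \<Rightarrow> nat) \<Rightarrow> bool" where
  "square a b c d \<longleftrightarrow> (\<exists>r s.
     (r \<noteq> s \<and> d = c(r := Suc (c r)) \<and> a = c(s := Suc (c s)) \<and> b = a(r := Suc (a r))) \<or>
     (d = c(s := Suc (c s)) \<and> a = d \<and> b = a(r := Suc (a r)) \<and>
        (r = s \<or> r = Suc s \<and> c r = c s)) \<or>
     (r \<noteq> s \<and> c = d(r := Suc (d r)) \<and> b = d(s := Suc (d s)) \<and> a = b(r := Suc (b r))) \<or>
     (c = d(s := Suc (d s)) \<and> b = c \<and> a = b(Suc s := Suc (b (Suc s)))))"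

lemma square_grow:
  "\<lbrakk>r \<noteq> s; d = c(r := Suc (c r)); a = c(s := Suc (c s)); b = a(r := Suc (a r))\<rbrakk> \<Longrightarrow> square a b c d"
  and square_grow_same:
  "\<lbrakk>d = c(s := Suc (c s)); a = d; b = a(s := Suc (a s))\<rbrakk> \<Longrightarrow> square a b c d"
  and square_grow_below:
  "\<lbrakk>d = c(s := Suc (c s)); a = d; b = a(Suc s := Suc (a (Suc s))); c (Suc s) = c s\<rbrakk> \<Longrightarrow> square a b c d"
  and square_shrink:
  "\<lbrakk>r \<noteq> s; c = d(r := Suc (d r)); b = d(s := Suc (d s)); a = b(r := Suc (b r))\<rbrakk> \<Longrightarrow> square a b c d"
  and square_shrink_up:
  "\<lbrakk>c = d(s := Suc (d s)); b = c; a = b(Suc s := Suc (b (Suc s)))\<rbrakk> \<Longrightarrow> square a b c d"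
  unfolding square_def by blast+

section \<open>One insertion step while the full word has the larger tableau\<close>

lemma symplectic_grow_strict:
  assumes "grow y S k S'" and "symplectic S'" and "k = Suc j"
  shows "length (S k) < length (S j)"
  using assms grow_length[OF assms(1)] unfolding symplectic_def
  by (metis Suc_le_eq n_not_Suc_n)

lemma symplectic_shrink_strict:
  assumes "shrink y S k S'" and "symplectic S'"
  shows "length (S (Suc k)) < length (S k)"
proof -
  have "length (S' (Suc k)) \<le> length (S' k)" using assms(2) by (simp add: symplectic_def)
  then show ?thesis
    using shrink_length[OF assms(1), of k] shrink_length[OF assms(1), of "Suc k"] shrink_length_pos[OF assms(1)]
    by (simp only: if_True if_False refl n_not_Suc_n n_not_Suc_n[symmetric])
qed

lemma markedI:
  assumes "symplectic S" and "\<forall>a \<in> letters S. a < x" and "strip x S \<nu>" and "strip x S \<nu>'"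
    and "\<nu>' = \<nu>(c := Suc (\<nu> c))" and "\<forall>i < c. \<nu> i = length (S i)"
  shows "marked x (fill x S \<nu>') (fill x S \<nu>) c"
  using assms unfolding marked_def by blast

lemma fill_step:
  assumes "symplectic S'" and "\<forall>a \<in> letters S'. a < x" and "strip x S' \<nu>'"
    and "grow y R k (fill x S' \<nu>') \<or> shrink y R k (fill x S' \<nu>')"
  shows "berele_step y R (fill x S' \<nu>')"
  using assms symplectic_fill by (auto simp: berele_step_def)

text \<open>Both fillings share the core \<open>S\<close>, so they undergo the same transition
  unless the marked \<open>x\<close> decides it. When it alone is bumped, the mark drops to the next
  row; when it alone moves up in a slide, the mark rises by one row. The second disjunct is its
  cancellation, after which \<open>Q'\<close> is the larger filling and has the old shape of
  \<open>R\<close>.\<close>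

lemma marked_step:
  assumes m: "marked x R R' c" and yx: "y < x" and y: "Unbarred (Suc 0) \<le> y"
  shows "\<exists>Q Q'. berele_step y R Q \<and> berele_step y R' Q' \<and>
    ((\<exists>c'. marked x Q Q' c') \<or>
     (\<exists>k. x = Barred (Suc k) \<and> lengths R = lengths Q' \<and> lengths R = (lengths Q)(k := Suc (length (Q k))) \<and>
        Q' = Q(k := Q k @ [Unbarred (Suc k)]) \<and> symplectic Q \<and> symplectic Q' \<and> (\<forall>a \<in> letters Q'. a < x)))"
proof -
  from m obtain S \<nu> where S: "symplectic S" and lt: "\<forall>a \<in> letters S. a < x"
    and st: "strip x S \<nu>" and st1: "strip x S (\<nu>(c := Suc (\<nu> c)))"
    and top: "\<forall>i < c. \<nu> i = length (S i)"
    and R: "R = fill x S (\<nu>(c := Suc (\<nu> c)))" and R': "R' = fill x S \<nu>"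
    unfolding marked_def by blast
  let ?\<nu>1 = "\<nu>(c := Suc (\<nu> c))"
  obtain S' where "berele_step y S S'"
  proof -
    have "\<forall>a \<in> letters S. letter_rank a \<le> letter_rank x" using lt by (auto simp: less_letter_def)
    moreover have "letter_rank y \<le> letter_rank x" using yx by (simp add: less_letter_def)
    ultimately show ?thesis using that berele_step_exists[OF S _ _ y] by blast
  qed
  then obtain k where S': "symplectic S'" and gs: "grow y S k S' \<or> shrink y S k S'"
    by (auto simp: berele_step_def)
  have lt': "\<forall>a \<in> letters S'. a < x"
    using gs grow_letters shrink_letters lt yx by blast
  note F = S S' lt yx st and F1 = S S' lt yx st1
  note step = fill_step[OF S' lt']
  from gs show ?thesis
  proof
    assume g: "grow y S k S'"
    note len = grow_length[OF g]
    show ?thesis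
    proof (cases "\<nu> k = length (S k)")
      case app: True
      note a = fill_grow_append[OF F g app]
      show ?thesis
      proof (cases "k = c")
        case False
        then have app1: "?\<nu>1 k = length (S k)" using app by simp
        note a1 = fill_grow_append[OF F1 g app1]
        have "marked x (fill x S' (?\<nu>1(k := Suc (?\<nu>1 k)))) (fill x S' (\<nu>(k := Suc (\<nu> k)))) c"
          using False top len by (intro markedI S' lt' a(2) a1(2)) (auto simp: app)
        then show ?thesis using step[OF a(2)] step[OF a1(2)] a(1) a1(1) unfolding R R' by blast
      next
        case kc: True
        then have app1: "?\<nu>1 k \<noteq> length (S k)" using app by simp
        show ?thesis
        proof (cases "x = Barred (Suc k)")
          case False
          note b1 = fill_grow_bump[OF F1 g app1 False]
          have "marked x (fill x S' (?\<nu>1(Suc k := Suc (?\<nu>1 (Suc k))))) (fill x S' (\<nu>(k := Suc (\<nu> k)))) (Suc c)"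
            using top len app kc by (intro markedI S' lt' a(2) b1(2)) (auto simp: less_Suc_eq)
          then show ?thesis using step[OF a(2)] step[OF b1(2)] a(1) b1(1) unfolding R R' by blast
        next
          case True
          note b1 = fill_cancel[OF F1 g app1 True]
          let ?Q = "S'(k := S k)"
          \<comment> \<open>After the cancellation no \<open>x\<close> is left: \<open>R'\<close>
            has none in the rows up to \<open>c\<close>, and the rows below \<open>c\<close> are too
            low for \<open>Barred (Suc k)\<close>.\<close>
          have "\<nu> i = length (S i)" for i
          proof (cases "i \<le> c")
            case True
            then show ?thesis using top app kc by (cases "i = c") auto
          next
            case False
            then have "\<not> Unbarred (Suc i) \<le> x" using True kc by (simp add: less_eq_letter_def)
            then show ?thesis using st unfolding strip_def by (metis le_neq_implies_less)
          qed
          then have \<nu>: "\<nu> = lengths S" by (simp add: fun_eq_iff)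
          have Q: "fill x ?Q (?\<nu>1(k := ?\<nu>1 k - 1)) = ?Q"
            using kc len by (auto simp: fill_def \<nu> fun_eq_iff)
          have Q': "fill x S' (\<nu>(k := Suc (\<nu> k))) = S'"
            using kc len by (auto simp: fill_def \<nu> fun_eq_iff)
          have "lengths R = lengths S'" "lengths R = (lengths ?Q)(k := Suc (length (?Q k)))"
            using len unfolding R length_fill[OF st1] by (auto simp: \<nu> kc fun_eq_iff)
          moreover have "S' = ?Q(k := ?Q k @ [Unbarred (Suc k)])" using b1(4) by auto
          moreover have "berele_step y R ?Q" using b1(1,3) unfolding Q R[symmetric]
            by (auto simp: berele_step_def)
          moreover have "berele_step y R' S'" using a(1) S' unfolding Q' R'[symmetric]
            by (auto simp: berele_step_def)
          ultimately show ?thesis using True b1(3) S' lt' by blast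
        qed
      qed
    next
      case bump: False
      \<comment> \<open>Row \<open>k\<close> contains an \<open>x\<close> even in \<open>R'\<close>,
        so it is not above row \<open>c\<close>. Both fillings lose an \<open>x\<close> from row
        \<open>k\<close>, and the mark can stay in row \<open>c\<close>.\<close>
      then have kc: "c \<le> k" using top by (meson not_le)
      have bump1: "?\<nu>1 k \<noteq> length (S k)" using bump st unfolding strip_def by (auto dest: spec[of _ k])
      show ?thesis
      proof (cases "x = Barred (Suc k)")
        case False
        note b = fill_grow_bump[OF F g bump False] and b1 = fill_grow_bump[OF F1 g bump1 False]
        have "marked x (fill x S' (?\<nu>1(Suc k := Suc (?\<nu>1 (Suc k))))) (fill x S' (\<nu>(Suc k := Suc (\<nu> (Suc k))))) c"
          using kc top len by (intro markedI S' lt' b(2) b1(2)) auto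
        then show ?thesis using step[OF b(2)] step[OF b1(2)] b(1) b1(1) unfolding R R' by blast
      next
        case True
        note b = fill_cancel[OF F g bump True] and b1 = fill_cancel[OF F1 g bump1 True]
        let ?S = "S'(k := S k)"
        have "letters ?S \<subseteq> letters S' \<union> letters S"
          by (auto simp: letters_def split: if_splits)
        then have lt2: "\<forall>a \<in> letters ?S. a < x" using lt' lt by blast
        have pos: "0 < \<nu> k" using bump st unfolding strip_def by (metis gr0I le_zero_eq)
        have "marked x (fill x ?S (?\<nu>1(k := ?\<nu>1 k - 1))) (fill x ?S (\<nu>(k := \<nu> k - 1))) c"
          using kc top len pos by (intro markedI b(3) lt2 b(2) b1(2)) (auto simp: fun_eq_iff)
        then show ?thesis using fill_step[OF b(3) lt2 b(2)] fill_step[OF b(3) lt2 b1(2)] b(1) b1(1)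
          unfolding R R' by blast
      qed
    qed
  next
    assume g: "shrink y S k S'"
    note len = shrink_length[OF g]
    note dec = symplectic_shrink_strict[OF g S'] and pos = shrink_length_pos[OF g]
    show ?thesis
    proof (cases "\<nu> (Suc k) = length (S k)")
      case b: True
      then have "c \<noteq> Suc k" using st1 unfolding strip_def by (auto dest!: spec[of _ k])
      then have b1: "?\<nu>1 (Suc k) = length (S k)" using b by simp
      have ck: "c \<le> k"
      proof (rule ccontr)
        assume "\<not> c \<le> k"
        then have "\<nu> (Suc k) = length (S (Suc k))" using top \<open>c \<noteq> Suc k\<close> by simp
        then show False using dec b by simp
      qed
      note d = fill_shrink_below[OF F g b] and d1 = fill_shrink_below[OF F1 g b1]
      have "marked x (fill x S' (?\<nu>1(Suc k := ?\<nu>1 (Suc k) - 1))) (fill x S' (\<nu>(Suc k := \<nu> (Suc k) - 1))) c"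
        using ck top len by (intro markedI S' lt' d(2) d1(2)) auto
      then show ?thesis using step[OF d(2)] step[OF d1(2)] d(1) d1(1) unfolding R R' by blast
    next
      case nb: False
      note d = fill_shrink_beside[OF F g nb]
      have posk: "0 < \<nu> k" using pos st unfolding strip_def by (metis less_le_trans)
      show ?thesis
      proof (cases "?\<nu>1 (Suc k) = length (S k)")
        case True
        \<comment> \<open>Only in \<open>R\<close> is there an \<open>x\<close> below the corner
          vacated by \<open>S\<close>. It is the marked one, and it moves up into row
          \<open>k\<close>.\<close>
        then have c: "c = Suc k" using nb by (auto split: if_splits)
        note d1 = fill_shrink_below[OF F1 g True]
        have "marked x (fill x S' (?\<nu>1(Suc k := ?\<nu>1 (Suc k) - 1))) (fill x S' (\<nu>(k := \<nu> k - 1))) k"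
          using c top len posk by (intro markedI S' lt' d(2) d1(2)) (auto simp: fun_eq_iff)
        then show ?thesis using step[OF d(2)] step[OF d1(2)] d(1) d1(1) unfolding R R' by blast
      next
        case False
        note d1 = fill_shrink_beside[OF F1 g False]
        have "marked x (fill x S' (?\<nu>1(k := ?\<nu>1 k - 1))) (fill x S' (\<nu>(k := \<nu> k - 1))) c"
          using top len posk by (intro markedI S' lt' d(2) d1(2)) (auto simp: fun_eq_iff)
        then show ?thesis using step[OF d(2)] step[OF d1(2)] d(1) d1(1) unfolding R R' by blast
      qed
    qed
  qed
qed

section \<open>One insertion step while the shortened word has the larger tableau\<close>

lemma fill_append_cell:
  assumes "length (S k) \<le> \<nu> k"
  shows "fill x S (\<nu>(k := Suc (\<nu> k))) = (fill x S \<nu>)(k := fill x S \<nu> k @ [x])"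
  using assms by (auto simp: fill_def fun_eq_iff Suc_diff_le replicate_append_same)

lemma supplementedI:
  assumes "symplectic S" and "\<forall>a \<in> letters S. a < x" and "strip x S \<nu>" and "strip x S \<nu>'"
    and "\<nu>' = \<nu>(c := Suc (\<nu> c))" and "\<forall>i \<ge> c. \<nu> (Suc i) = length (S i)"
  shows "supplemented x (fill x S \<nu>) (fill x S \<nu>') c"
  using assms unfolding supplemented_def by blast

text \<open>An unbarred \<open>x\<close> is never cancelled, so the additional cell persists. Equal
  transitions on both sides give (J), (W) or a horizontal domino. The additional \<open>x\<close>
  decides in two situations only: a bump out of row \<open>c\<close>, which gives a vertical domino,
  and a slide of the core ending just above row \<open>c\<close>, which gives (Ya).\<close>

lemma supplemented_step:
  assumes m: "supplemented x R R' c" and x: "x = Unbarred l" and yx: "y \<le> x"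
    and y: "Unbarred (Suc 0) \<le> y"
  shows "\<exists>Q Q' c'. berele_step y R Q \<and> berele_step y R' Q' \<and> supplemented x Q Q' c' \<and>
    square (lengths R') (lengths Q') (lengths R) (lengths Q)"
proof -
  from m obtain S \<nu> where S: "symplectic S" and lt: "\<forall>a \<in> letters S. a < x"
    and st: "strip x S \<nu>" and st1: "strip x S (\<nu>(c := Suc (\<nu> c)))"
    and bot: "\<forall>i \<ge> c. \<nu> (Suc i) = length (S i)"
    and R: "R = fill x S \<nu>" and R': "R' = fill x S (\<nu>(c := Suc (\<nu> c)))"
    unfolding supplemented_def by blast
  let ?\<nu>1 = "\<nu>(c := Suc (\<nu> c))"
  have nb: "x \<noteq> Barred k" for k using x by simp
  have len_R: "lengths R = \<nu>" "lengths R' = ?\<nu>1"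
    unfolding R R' using length_fill[OF st] length_fill[OF st1] by (auto simp: fun_eq_iff)
  have main: ?thesis
    if "symplectic S'" "\<forall>a \<in> letters S'. a < x" "strip x S' \<mu>" "strip x S' \<mu>'"
      "\<mu>' = \<mu>(c' := Suc (\<mu> c'))" "\<forall>i \<ge> c'. \<mu> (Suc i) = length (S' i)"
      "square ?\<nu>1 \<mu>' \<nu> \<mu>"
      "berele_step y R (fill x S' \<mu>)" "berele_step y R' (fill x S' \<mu>')" for S' \<mu> \<mu>' c'
  proof -
    have "lengths (fill x S' \<mu>) = \<mu>" "lengths (fill x S' \<mu>') = \<mu>'"
      using length_fill[OF that(3)] length_fill[OF that(4)] by (auto simp: fun_eq_iff)
    then show ?thesis using supplementedI[OF that(1-6)] that(7-9) unfolding len_R by metis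
  qed
  show ?thesis
  proof (cases "y = x")
    case True
    have le: "\<forall>a \<in> letters R. a \<le> x" "\<forall>a \<in> letters R'. a \<le> x"
      using lt letters_fill[of x S] unfolding R R' by (fastforce dest: less_imp_le)+
    let ?\<mu> = "\<nu>(0 := Suc (\<nu> 0))" and ?\<mu>1 = "?\<nu>1(0 := Suc (?\<nu>1 0))"
    have st': "strip x S ?\<mu>" "strip x S ?\<mu>1" using st st1 y True unfolding strip_def by (auto simp: le_SucI)
    have "length (S 0) \<le> \<nu> 0" using st unfolding strip_def by blast
    then have l: "length (S 0) \<le> \<nu> 0" "length (S 0) \<le> ?\<nu>1 0" by auto
    note Q = fill_append_cell[of S 0 \<nu> x, OF l(1), folded R] fill_append_cell[of S 0 ?\<nu>1 x, OF l(2), folded R']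
    have sq: "square ?\<nu>1 ?\<mu>1 \<nu> ?\<mu>"
      by (cases "c = 0") (auto intro: square_grow[of 0 c] square_grow_same[of _ _ 0])
    have "berele_step y R (fill x S ?\<mu>)" "berele_step y R' (fill x S ?\<mu>1)"
      unfolding Q True using y True le symplectic_fill[OF S lt st] symplectic_fill[OF S lt st1]
      by (auto intro!: berele_step_max simp: R R')
    then show ?thesis using bot sq by (intro main[OF S lt st', of c]) (auto simp: fun_eq_iff)
  next
    case False
    then have yx: "y < x" using yx by simp
    obtain S' where "berele_step y S S'"
    proof -
      have "\<forall>a \<in> letters S. letter_rank a \<le> letter_rank x" using lt by (auto simp: less_letter_def)
      moreover have "letter_rank y \<le> letter_rank x" using yx by (simp add: less_letter_def)
    ultimately show ?thesis using that berele_step_exists[OF S _ _ y] by blast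
    qed
    then obtain k where S': "symplectic S'" and gs: "grow y S k S' \<or> shrink y S k S'"
      by (auto simp: berele_step_def)
    have lt': "\<forall>a \<in> letters S'. a < x"
      using gs grow_letters shrink_letters lt yx by blast
    note F = S S' lt yx st and F1 = S S' lt yx st1
    note step = fill_step[OF S' lt'] and main = main[OF S' lt']
    from gs show ?thesis
    proof
      assume g: "grow y S k S'"
      note len = grow_length[OF g]
      have dec: "\<And>j. k = Suc j \<Longrightarrow> length (S k) < length (S j)"
        using symplectic_grow_strict[OF g S'] .
      show ?thesis
      proof (cases "\<nu> k = length (S k)")
        case app: True
        \<comment> \<open>Below row \<open>c\<close> the strip is as long as interlacing allows. A
          row there in which the core can grow is strictly shorter in the core than the row above
          it, hence contains an \<open>x\<close>.\<close>
        have kc: "k \<le> c"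
        proof (rule ccontr)
          assume "\<not> k \<le> c"
          then obtain j where "k = Suc j" "c \<le> j" by (cases k) auto
          then show False using bot dec app by simp
        qed
        note a = fill_grow_append[OF F g app]
        show ?thesis
        proof (cases "k = c")
          case False
          then have app1: "?\<nu>1 k = length (S k)" using app by simp
          note a1 = fill_grow_append[OF F1 g app1]
          have "square ?\<nu>1 (?\<nu>1(k := Suc (?\<nu>1 k))) \<nu> (\<nu>(k := Suc (\<nu> k)))"
            using False by (intro square_grow[of k c]) auto
          note sq = this
          note s1 = step[OF a(2) disjI1, OF a(1), folded R] and s2 = step[OF a1(2) disjI1, OF a1(1), folded R']
          show ?thesis
          proof (rule main[where c' = c, OF a(2) a1(2) _ _ sq s1 s2])
          qed (use False kc bot len in auto)
        next
          case kc: True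
          then have app1: "?\<nu>1 k \<noteq> length (S k)" using app by simp
          note b1 = fill_grow_bump[OF F1 g app1 nb]
          \<comment> \<open>Equal row lengths put the two new cells into the same column.\<close>
          have "\<nu> (Suc c) = \<nu> c" using bot app kc by simp
          then have "square ?\<nu>1 (?\<nu>1(Suc k := Suc (?\<nu>1 (Suc k)))) \<nu> (\<nu>(k := Suc (\<nu> k)))"
            using kc by (intro square_grow_below[of _ _ c]) auto
          note sq = this
          note s1 = step[OF a(2) disjI1, OF a(1), folded R] and s2 = step[OF b1(2) disjI1, OF b1(1), folded R']
          show ?thesis
          proof (rule main[where c' = "Suc c", OF a(2) b1(2) _ _ sq s1 s2])
          qed (use kc bot len in auto)
        qed
      next
        case bump: False
        have bump1: "?\<nu>1 k \<noteq> length (S k)" using bump st unfolding strip_def by (auto dest: spec[of _ k])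
        note b = fill_grow_bump[OF F g bump nb] and b1 = fill_grow_bump[OF F1 g bump1 nb]
        have "square ?\<nu>1 (?\<nu>1(Suc k := Suc (?\<nu>1 (Suc k)))) \<nu> (\<nu>(Suc k := Suc (\<nu> (Suc k))))"
          by (cases "c = Suc k") (auto intro: square_grow[of "Suc k" c] square_grow_same[of _ _ "Suc k"])
        note sq = this
        note s1 = step[OF b(2) disjI1, OF b(1), folded R] and s2 = step[OF b1(2) disjI1, OF b1(1), folded R']
        show ?thesis
        proof (rule main[where c' = c, OF b(2) b1(2) _ _ sq s1 s2])
        qed (use bot len in auto)
      qed
    next
      assume g: "shrink y S k S'"
      note len = shrink_length[OF g]
      note pos = shrink_length_pos[OF g]
      have posk: "0 < \<nu> k" using pos st unfolding strip_def by (metis less_le_trans)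
      show ?thesis
      proof (cases "\<nu> (Suc k) = length (S k)")
        case b: True
        then have ck: "c \<noteq> Suc k" using st1 unfolding strip_def by (auto dest!: spec[of _ k])
        then have b1: "?\<nu>1 (Suc k) = length (S k)" using b by simp
        note d = fill_shrink_below[OF F g b] and d1 = fill_shrink_below[OF F1 g b1]
        have "square ?\<nu>1 (?\<nu>1(Suc k := ?\<nu>1 (Suc k) - 1)) \<nu> (\<nu>(Suc k := \<nu> (Suc k) - 1))"
          using ck b pos by (intro square_shrink[of "Suc k" c]) (auto simp: fun_eq_iff)
        note sq = this
        note s1 = step[OF d(2) disjI2, OF d(1), folded R] and s2 = step[OF d1(2) disjI2, OF d1(1), folded R']
        show ?thesis
        proof (rule main[where c' = c, OF d(2) d1(2) _ _ sq s1 s2])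
        qed (use ck b bot len in auto)
      next
        case nbel: False
        then have kc: "k < c" using bot by (meson not_le)
        note d = fill_shrink_beside[OF F g nbel]
        show ?thesis
        proof (cases "?\<nu>1 (Suc k) = length (S k)")
          case True
          then have c: "c = Suc k" using nbel by (auto split: if_splits)
          note d1 = fill_shrink_below[OF F1 g True]
          have "square ?\<nu>1 (?\<nu>1(Suc k := ?\<nu>1 (Suc k) - 1)) \<nu> (\<nu>(k := \<nu> k - 1))"
            using c posk by (intro square_shrink_up[of _ _ k]) (auto simp: fun_eq_iff)
          note sq = this
          have "\<nu> (Suc k) = length (S k) - 1" using True c by simp
          note s1 = step[OF d(2) disjI2, OF d(1), folded R] and s2 = step[OF d1(2) disjI2, OF d1(1), folded R']
          show ?thesis
          proof (rule main[where c' = k, OF d(2) d1(2) _ _ sq s1 s2])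
          qed (use c bot posk len \<open>\<nu> (Suc k) = length (S k) - 1\<close> in \<open>auto simp: fun_eq_iff le_Suc_eq\<close>)
        next
          case False
          note d1 = fill_shrink_beside[OF F1 g False]
          have "square ?\<nu>1 (?\<nu>1(k := ?\<nu>1 k - 1)) \<nu> (\<nu>(k := \<nu> k - 1))"
            using kc posk by (intro square_shrink[of k c]) (auto simp: fun_eq_iff)
          note sq = this
          note s1 = step[OF d(2) disjI2, OF d(1), folded R] and s2 = step[OF d1(2) disjI2, OF d1(1), folded R']
          show ?thesis
          proof (rule main[where c' = c, OF d(2) d1(2) _ _ sq s1 s2])
          qed (use kc bot len in auto)
        qed
      qed
    qed
  qed
qed

section \<open>Local rules applied backwards\<close>

definition part :: "partition \<Rightarrow> nat \<Rightarrow> nat" where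
  "part \<nu> i = (if i < length \<nu> then \<nu> ! i else 0)"

lemma part_shape: "part (shape T) = lengths (row T)"
  by (auto simp: part_def shape_def row_def fun_eq_iff)

lemma part_pos_iff: "is_partition \<nu> \<Longrightarrow> 0 < part \<nu> i \<longleftrightarrow> i < length \<nu>"
  by (auto simp: part_def is_partition_def)

lemma part_inject:
  assumes "is_partition \<mu>" and "is_partition \<nu>" and eq: "part \<mu> = part \<nu>"
  shows "\<mu> = \<nu>"
proof -
  have i: "i < length \<mu> \<longleftrightarrow> i < length \<nu>" for i
    using assms part_pos_iff by metis
  then have "length \<mu> = length \<nu>" by (meson linorder_neqE_nat less_irrefl)
  moreover have "\<mu> ! i = \<nu> ! i" if "i < length \<mu>" for i
    using eq that i by (metis part_def)
  ultimately show ?thesis by (rule nth_equalityI)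
qed

lemma part_Suc_le: "is_partition \<nu> \<Longrightarrow> part \<nu> (Suc i) \<le> part \<nu> i"
  by (auto simp: part_def is_partition_def sorted_wrt_iff_nth_less)

lemma mem_cells_iff: "(i, j) \<in> cells \<nu> \<longleftrightarrow> 1 \<le> i \<and> 1 \<le> j \<and> j \<le> part \<nu> (i - 1)"
  by (auto simp: cells_def part_def)

lemma card_cells_row: "card {j. (Suc p, j) \<in> cells \<nu>} = part \<nu> p"
proof -
  have "{j. (Suc p, j) \<in> cells \<nu>} = {1..part \<nu> p}" by (auto simp: mem_cells_iff)
  then show ?thesis by simp
qed

text \<open>Counting cells row by row turns the set equation into one increment; \<open>k\<close>
  counts rows from 1 and \<open>r\<close> from 0.\<close>

lemma covered_iff:
  "covered k \<mu> \<nu> \<longleftrightarrow> is_partition \<mu> \<and> is_partition \<nu> \<and>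
     (\<exists>r. k = Suc r \<and> part \<nu> = (part \<mu>)(r := Suc (part \<mu> r)))"
proof
  assume "covered k \<mu> \<nu>"
  then obtain j where p: "is_partition \<mu>" "is_partition \<nu>"
    and j: "(k, j) \<notin> cells \<mu>" "cells \<nu> = insert (k, j) (cells \<mu>)"
    by (auto simp: covered_def)
  then have "(k, j) \<in> cells \<nu>" by simp
  then obtain r where k: "k = Suc r" by (cases k) (auto simp: mem_cells_iff)
  have "part \<nu> q = ((part \<mu>)(r := Suc (part \<mu> r))) q" for q
  proof (cases "q = r")
    case True
    have "{i. (Suc q, i) \<in> cells \<nu>} = insert j {i. (Suc q, i) \<in> cells \<mu>}"
      using j(2) k True by auto
    moreover have "finite {i. (Suc q, i) \<in> cells \<mu>}"
      by (rule finite_subset[of _ "{..part \<mu> q}"]) (auto simp: mem_cells_iff)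
    ultimately have "part \<nu> q = Suc (part \<mu> q)"
      using j(1) k True card_cells_row[of q] by (metis card_insert_disjoint mem_Collect_eq)
    then show ?thesis using True by simp
  next
    case False
    then have "{i. (Suc q, i) \<in> cells \<nu>} = {i. (Suc q, i) \<in> cells \<mu>}"
      using j(2) k by auto
    then show ?thesis using False card_cells_row[of q] by (metis fun_upd_other)
  qed
  then show "is_partition \<mu> \<and> is_partition \<nu> \<and>
     (\<exists>r. k = Suc r \<and> part \<nu> = (part \<mu>)(r := Suc (part \<mu> r)))"
    using p k by blast
next
  assume "is_partition \<mu> \<and> is_partition \<nu> \<and>
     (\<exists>r. k = Suc r \<and> part \<nu> = (part \<mu>)(r := Suc (part \<mu> r)))"
  then obtain r where p: "is_partition \<mu>" "is_partition \<nu>" and k: "k = Suc r"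
    and r: "part \<nu> = (part \<mu>)(r := Suc (part \<mu> r))" by blast
  have "cells \<nu> = insert (k, Suc (part \<mu> r)) (cells \<mu>)"
    using k by (auto simp: mem_cells_iff r le_Suc_eq split: if_splits)
  moreover have "(k, Suc (part \<mu> r)) \<notin> cells \<mu>" using k by (simp add: mem_cells_iff)
  ultimately show "covered k \<mu> \<nu>" using p unfolding covered_def by blast
qed

text \<open>The row is forgotten on purpose: most local rules are excluded merely by the direction
  of their steps.\<close>

definition up :: "partition \<Rightarrow> partition \<Rightarrow> bool" where
  "up \<mu> \<nu> \<longleftrightarrow> (\<exists>r. part \<nu> = (part \<mu>)(r := Suc (part \<mu> r)))"

lemma covered_up: "covered k \<mu> \<nu> \<Longrightarrow> up \<mu> \<nu>"
  by (auto simp: covered_iff up_def)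

lemma covered_some_up: "covered_some \<mu> \<nu> \<Longrightarrow> up \<mu> \<nu>"
  by (auto simp: covered_some_def covered_up)

lemma up_asym: "up \<mu> \<nu> \<Longrightarrow> \<not> up \<nu> \<mu>"
  unfolding up_def by (metis fun_upd_apply lessI less_SucI less_not_refl)

lemma up_irrefl: "\<not> up \<mu> \<mu>"
  using up_asym by blast

lemma fun_upd_Suc_eqD:
  fixes g :: "nat \<Rightarrow> nat"
  shows "g(r := Suc (g r)) = g(s := Suc (g s)) \<Longrightarrow> r = s"
  by (metis fun_upd_apply n_not_Suc_n)

section \<open>Determinism of the backward rules along known shapes\<close>

lemma cells_diff_two:
  assumes "part B = (part A)(r := Suc (part A r))" and "part A = (part C)(s := Suc (part C s))"
  shows "cells B - cells C = {(Suc r, Suc (part A r)), (Suc s, Suc (part C s))}"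
  using assms by (auto simp: mem_cells_iff le_Suc_eq split: if_splits)

lemma is_domino_doubletonD:
  "is_domino {(a, b), (c, d)} \<Longrightarrow> a = c \<or> b = d \<and> (a = Suc c \<or> c = Suc a)"
  unfolding is_domino_def by (elim exE disjE) (auto simp: doubleton_eq_iff)

text \<open>The inclusions among \<open>B\<close>, \<open>C\<close> and \<open>D\<close> single out
  one kind of rule, which then determines \<open>A\<close>. Only in the case (Ya) does (O) compete:
  it would require the cell of \<open>C\<close> outside \<open>D\<close> to lie in row
  \<open>l\<close> or lower, but then the cell that \<open>A\<close> gains would lie below row
  \<open>l\<close>, against the row bound.\<close>

lemma backward_rule_square:
  assumes sq: "square (part A) (part B) (part C) (part D)"
    and p: "is_partition A" "is_partition B" "is_partition C" "is_partition D"
    and l: "\<forall>i \<ge> l. part A i = 0"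
    and br: "backward_rule (Barred l) B C D r A'"
  shows "A' = A \<and> r \<noteq> RuleO"
proof -
  from br obtain c where lr: "local_rule (Barred l) r A' B C D c"
    by (auto simp: backward_rule_def)
  from sq consider
    (grow) i j where "i \<noteq> j" "part D = (part C)(i := Suc (part C i))"
      "part A = (part C)(j := Suc (part C j))" "part B = (part A)(i := Suc (part A i))"
  | (domino) i j where "part D = (part C)(j := Suc (part C j))" "part A = part D"
      "part B = (part A)(i := Suc (part A i))" "i = j \<or> i = Suc j \<and> part C i = part C j"
  | (shrink) i j where "i \<noteq> j" "part C = (part D)(i := Suc (part D i))"
      "part B = (part D)(j := Suc (part D j))" "part A = (part B)(i := Suc (part B i))"
  | (up) j where "part C = (part D)(j := Suc (part D j))" "part B = part C"
      "part A = (part B)(Suc j := Suc (part B (Suc j)))"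
    unfolding square_def by blast
  then show ?thesis
  proof cases
    case grow
    have CD: "up C D" using grow by (auto simp: up_def)
    have DB: "up D B" unfolding up_def using grow by (intro exI[of _ j]) (auto simp: fun_upd_twist)
    \<comment> \<open>Two adjacent cells can be added in one order only, whereas \<open>A\<close>
      and \<open>D\<close> realise both orders.\<close>
    have nd: "\<not> is_domino (cells B - cells C)"
    proof
      assume "is_domino (cells B - cells C)"
      moreover have "cells B - cells C = {(Suc i, Suc (part C i)), (Suc j, Suc (part C j))}"
        using cells_diff_two[OF grow(4,3)] grow(1,3) by simp
      ultimately have "part C i = part C j \<and> (i = Suc j \<or> j = Suc i)"
        using grow(1) is_domino_doubletonD by fastforce
      moreover have "part D (Suc j) \<le> part D j" "part A (Suc i) \<le> part A i"
        using p part_Suc_le by auto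
      ultimately show False using grow by auto
    qed
    \<comment> \<open>Between \<open>C\<close> and \<open>B\<close> there are exactly the two shapes
      \<open>A\<close> and \<open>D\<close>, and (J) excludes \<open>D\<close>.\<close>
    have two: "A' = A" if "up C A'" "up A' B" "A' \<noteq> D" "is_partition A'"
    proof -
      from that obtain q where q: "part A' = (part C)(q := Suc (part C q))" by (auto simp: up_def)
      from that obtain q' where q': "part B = (part A')(q' := Suc (part A' q'))" by (auto simp: up_def)
      have "q = i \<or> q = j"
      proof (rule ccontr)
        assume "\<not> (q = i \<or> q = j)"
        then have "part B q = part C q" using grow by simp
        moreover have "part A' q \<le> part B q" using q' by simp
        ultimately show False using q by simp
      qed
      moreover have "q \<noteq> i" using that(3,4) q grow(2) p(4) part_inject by metis
      ultimately have "part A' = part A" using q grow(3) by simp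
      then show ?thesis using that(4) p(1) part_inject by blast
    qed
    from lr show ?thesis
      by cases (use CD DB nd two up_asym up_irrefl covered_up covered_some_up covered_some_def
          covered_iff in \<open>metis rule_case.distinct\<close>)+
  next
    case domino
    have CD: "up C D" using domino by (auto simp: up_def)
    have DB: "up D B" using domino by (auto simp: up_def)
    have "A = D" using domino(2) p part_inject by blast
    have d: "is_domino (cells B - cells C)"
    proof -
      have c: "cells B - cells C = {(Suc i, Suc (part A i)), (Suc j, Suc (part C j))}"
        using cells_diff_two[OF domino(3)] domino(1,2) by simp
      show ?thesis
        using domino(4)
      proof
        assume "i = j"
        then have "cells B - cells C = {(Suc j, Suc (part C j)), (Suc j, Suc (Suc (part C j)))}"
          using c domino by auto
        then show ?thesis unfolding is_domino_def by blast
      next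
        assume "i = Suc j \<and> part C i = part C j"
        then have "cells B - cells C = {(Suc j, Suc (part C j)), (Suc (Suc j), Suc (part C j))}"
          using c domino by auto
        then show ?thesis unfolding is_domino_def by blast
      qed
    qed
    from lr show ?thesis
      by cases (use CD DB d \<open>A = D\<close> up_asym up_irrefl covered_up covered_some_up in
          \<open>metis rule_case.distinct\<close>)+
  next
    case shrink
    have DC: "up D C" using shrink by (auto simp: up_def)
    have DB: "up D B" using shrink by (auto simp: up_def)
    have BC: "B \<noteq> C" using shrink fun_upd_Suc_eqD by metis
    have w: "A' = A" if "covered k B A'" "covered k D C" for k
    proof -
      have "k = Suc i" using that(2) shrink(2) fun_upd_Suc_eqD unfolding covered_iff by metis
      then have "part A' = part A" using that(1) shrink(4) unfolding covered_iff by simp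
      then show ?thesis using that(1) p(1) part_inject unfolding covered_iff by blast
    qed
    from lr show ?thesis
      by cases (use DC DB BC w up_asym up_irrefl covered_up covered_some_up in
          \<open>metis rule_case.distinct\<close>)+
  next
    case up
    have DC: "up D C" using up by (auto simp: up_def)
    have BC: "B = C" using up(2) p part_inject by blast
    have j: "k = Suc j" if "covered k D C" for k
      using that up(1) fun_upd_Suc_eqD unfolding covered_iff by metis
    have O: False if "covered k D C" "Barred l \<le> Barred k" for k
    proof -
      have "l \<le> Suc j" using j[OF that(1)] that(2) by (simp add: less_eq_letter_def)
      then show False using l up(3) by auto
    qed
    have ya: "A' = A" if "covered k B A'" "covered (k - 1) D C" "2 \<le> k" for k
    proof -
      have "k = Suc (Suc j)" using j[OF that(2)] that(3) by simp
      then have "part A' = part A" using that(1) up(3) unfolding covered_iff by simp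
      then show ?thesis using that(1) p(1) part_inject unfolding covered_iff by blast
    qed
    from lr show ?thesis
      by cases (use DC BC j O ya up_asym up_irrefl covered_up covered_some_up in
          \<open>metis rule_case.distinct\<close>)+
  qed
qed

text \<open>Only (O) and (Ya) fit \<open>B = C\<close> above \<open>D\<close>. The stratum forbids
  (Ya), which would create row \<open>l + 1\<close>, and (O) returns a shape below \<open>C\<close>;
  either way the test cannot go on.\<close>

lemma backward_rule_blocked:
  assumes p: "is_partition C" "is_partition D" and l: "0 < l"
    and C: "part C = (part D)(l - 1 := Suc (part D (l - 1)))"
    and br: "backward_rule (Barred l) C C D r A"
  shows "\<not> covered_some C A"
proof
  assume CA: "covered_some C A"
  from br obtain c where lr: "local_rule (Barred l) r A C C D c" and len: "length A \<le> l"
    by (auto simp: backward_rule_def)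
  have DC: "up D C" using C by (auto simp: up_def)
  have CA: "up C A" using CA by (rule covered_some_up)
  have k: "k = l" if "covered k D C" for k
    using that C l fun_upd_Suc_eqD unfolding covered_iff by (metis Suc_diff_1)
  have ya: False if "covered q C A" "covered (q - 1) D C" "2 \<le> q" for q
  proof -
    have "q = Suc l" using k[OF that(2)] that(3) by simp
    then have "0 < part A l" "is_partition A" using that(1) unfolding covered_iff by auto
    then show False using len part_pos_iff by force
  qed
  from lr show False
    by cases (use DC CA k ya up_asym up_irrefl covered_up covered_some_up in metis)+
qed

text \<open>\<open>q\<close> is the earliest position for which the retraced shapes are known: 0 if
  they accompany all of \<open>\<kappa>\<close>, otherwise the position reached by the cancelling
  step. The second alternative is the state behind the blocked cell, where the test has
  stopped.\<close>

lemma backward_test_unique: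
  assumes q: "q \<le> f"
    and sq: "\<And>j. \<lbrakk>q \<le> j; j < f\<rbrakk> \<Longrightarrow>
      square (part (\<sigma> j)) (part (\<sigma> (Suc j))) (part (\<kappa> ! j)) (part (\<kappa> ! Suc j))"
    and p: "\<And>j. \<lbrakk>q \<le> j; j \<le> f\<rbrakk> \<Longrightarrow> is_partition (\<sigma> j) \<and> is_partition (\<kappa> ! j) \<and> (\<forall>i \<ge> l. part (\<sigma> j) i = 0)"
    and blocked: "\<And>r A. \<lbrakk>0 < q; backward_rule (Barred l) (\<sigma> q) (\<kappa> ! (q - 1)) (\<kappa> ! q) r A\<rbrakk> \<Longrightarrow>
      \<not> covered_some (\<kappa> ! (q - 1)) A"
    and bt: "backward_test \<kappa> (Barred l) f (\<sigma> f) j \<tau>"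
  shows "q \<le> j \<and> j \<le> f \<and> \<tau> = \<sigma> j \<or> q = Suc j \<and> \<not> covered_some (\<kappa> ! j) \<tau>"
  using bt
proof induction
  case start
  then show ?case using q by simp
next
  case (step j \<tau> r A)
  then have *: "q \<le> j" "j \<le> f" "\<tau> = \<sigma> j" by auto
  show ?case
  proof (cases "q = j")
    case True
    then show ?thesis using blocked step * by auto
  next
    case False
    then obtain i where i: "j = Suc i" "q \<le> i" using * by (cases j) auto
    then have "A = \<sigma> i"
      using backward_rule_square[of "\<sigma> i" \<tau> "\<kappa> ! i" "\<kappa> ! j" l r A] step.hyps sq[of i] p[of i] p[of j] *
      by simp
    then show ?thesis using i * by simp
  qed
qed

section \<open>Words with one letter deleted\<close>

lemma letters_berele_P: "set w \<subseteq> Gamma n \<Longrightarrow> letters (row (berele_P n w)) \<subseteq> set w"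
proof (induction w rule: rev_induct)
  case Nil
  then show ?case by (simp add: berele_P_def letters_def)
next
  case (snoc y w)
  then show ?case using berele_step_letters[OF berele_step_berele_P[of w n y]] by auto
qed

lemma marked_start:
  assumes w: "set (w @ [x]) \<subseteq> Gamma n" and le: "\<forall>y \<in> set w. y \<le> x"
  shows "marked x (row (berele_P n (w @ [x]))) (row (berele_P n w)) 0"
proof -
  let ?R = "row (berele_P n w)"
  have R: "symplectic ?R" using w sp_tableau_berele_P[of w n] by (simp add: sp_tableau_row)
  have ge: "Unbarred (Suc 0) \<le> x" using w Gamma_ge by auto
  have leR: "\<forall>a \<in> letters ?R. a \<le> x" using letters_berele_P[of w n] w le by auto
  note F = fill_restrict_below[OF R leR]
  let ?S = "restrict_below x ?R" and ?\<nu> = "lengths ?R"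
  have st: "strip x ?S (?\<nu>(0 := Suc (?\<nu> 0)))"
    using F(2) ge unfolding strip_def by (auto simp: le_SucI)
  have "length (?S 0) \<le> ?\<nu> 0" using F(2) unfolding strip_def by blast
  then have "fill x ?S (?\<nu>(0 := Suc (?\<nu> 0))) = ?R(0 := ?R 0 @ [x])"
    using fill_append_cell[of ?S 0 ?\<nu> x] F(1) by simp
  moreover have "row (berele_P n (w @ [x])) = ?R(0 := ?R 0 @ [x])"
    using w berele_step_max[OF R leR ge] by (intro row_berele_P_snoc) auto
  ultimately show ?thesis
    using markedI[OF F(3,4,2) st refl] unfolding F(1) by simp
qed

text \<open>Once \<open>Barred (Suc k)\<close> is gone, the cancelling letter
  \<open>Unbarred (Suc k)\<close> is an upper bound. Row \<open>k\<close> then consists of copies of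
  it and all lower rows are empty, so the core has no cells from row \<open>k\<close> on and every
  column left of the new cell already contains the letter.\<close>

lemma supplemented_start:
  assumes Q: "symplectic Q" "symplectic Q'" and Q': "Q' = Q(k := Q k @ [Unbarred (Suc k)])"
    and lt: "\<forall>a \<in> letters Q'. a < Barred (Suc k)"
  shows "supplemented (Unbarred (Suc k)) Q Q' k"
proof -
  let ?x = "Unbarred (Suc k)"
  have le': "\<forall>a \<in> letters Q'. a \<le> ?x"
    using lt by (auto simp: less_letter_def less_eq_letter_def)
  have "letters Q \<subseteq> letters Q'" unfolding Q' by (auto simp: letters_def split: if_splits)
  then have le: "\<forall>a \<in> letters Q. a \<le> ?x" using le' by blast
  note F = fill_restrict_below[OF Q(1) le] and F' = fill_restrict_below[OF Q(2) le']
  have "restrict_below ?x Q' = restrict_below ?x Q"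
  proof
    fix i
    show "restrict_below ?x Q' i = restrict_below ?x Q i"
      unfolding restrict_below_def Q' by (simp add: takeWhile_tail)
  qed
  note F' = F'[unfolded this]
  have "lengths Q' = (lengths Q)(k := Suc (length (Q k)))" unfolding Q' by auto
  note F' = F'[unfolded this]
  have ge: "?x \<le> Unbarred (Suc i)" if "k \<le> i" for i using that by (simp add: less_eq_letter_def)
  have "length (restrict_below ?x Q i) = 0" if "k \<le> i" for i
  proof -
    have "\<not> a < ?x" if "a \<in> set (Q i)" for a
      using Q(1) that ge[OF \<open>k \<le> i\<close>] unfolding symplectic_def by (meson leD order_trans)
    then show ?thesis by (cases "Q i") (auto simp: restrict_below_def)
  qed
  moreover have "length (Q (Suc i)) = 0" if "k \<le> i" for i
    using F(2) calculation[OF that] unfolding strip_def by (metis le_zero_eq)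
  ultimately show ?thesis
    using supplementedI[OF F(3,4,2) F'(2) refl] unfolding F(1) F'(1) by simp
qed

text \<open>\<open>a\<close> and \<open>a'\<close> are either the prefixes up to the cancellation
  or, for a phase over the whole word, the empty word and a single \<open>l\<close>.\<close>

lemma supplemented_run:
  assumes "set a \<subseteq> Gamma n" and "set a' \<subseteq> Gamma n" and "set v \<subseteq> Gamma n"
    and "\<forall>y \<in> set v. y \<le> Unbarred l"
    and "supplemented (Unbarred l) (row (berele_P n a)) (row (berele_P n a')) c"
  shows "\<exists>c. supplemented (Unbarred l) (row (berele_P n (a @ v))) (row (berele_P n (a' @ v))) c"
    and "i < length v \<Longrightarrow>
      square (lengths (row (berele_P n (a' @ take i v)))) (lengths (row (berele_P n (a' @ take (Suc i) v))))
        (lengths (row (berele_P n (a @ take i v)))) (lengths (row (berele_P n (a @ take (Suc i) v))))"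
proof -
  have *: "(\<exists>c. supplemented (Unbarred l) (row (berele_P n (a @ v))) (row (berele_P n (a' @ v))) c) \<and>
    (\<forall>i < length v. square (lengths (row (berele_P n (a' @ take i v)))) (lengths (row (berele_P n (a' @ take (Suc i) v))))
        (lengths (row (berele_P n (a @ take i v)))) (lengths (row (berele_P n (a @ take (Suc i) v)))))"
    using assms(3,4)
  proof (induction v rule: rev_induct)
    case Nil
    then show ?case using assms(5) by auto
  next
    case (snoc y v)
    then have IH: "\<exists>c. supplemented (Unbarred l) (row (berele_P n (a @ v))) (row (berele_P n (a' @ v))) c"
      "\<forall>i < length v. square (lengths (row (berele_P n (a' @ take i v)))) (lengths (row (berele_P n (a' @ take (Suc i) v))))
        (lengths (row (berele_P n (a @ take i v)))) (lengths (row (berele_P n (a @ take (Suc i) v))))"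
      and y: "y \<in> Gamma n" "y \<le> Unbarred l" by auto
    from IH(1) obtain c where "supplemented (Unbarred l) (row (berele_P n (a @ v))) (row (berele_P n (a' @ v))) c" ..
    from supplemented_step[OF this refl y(2) Gamma_ge[OF y(1)]] obtain Q Q' c' where
      Q: "berele_step y (row (berele_P n (a @ v))) Q" "berele_step y (row (berele_P n (a' @ v))) Q'"
        "supplemented (Unbarred l) Q Q' c'"
        "square (lengths (row (berele_P n (a' @ v)))) (lengths Q') (lengths (row (berele_P n (a @ v)))) (lengths Q)"
      by blast
    have "row (berele_P n ((a @ v) @ [y])) = Q" "row (berele_P n ((a' @ v) @ [y])) = Q'"
      using row_berele_P_snoc[OF _ y(1) Q(1)] row_berele_P_snoc[OF _ y(1) Q(2)] assms(1,2) snoc.prems(1) by auto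
    then show ?case using Q(3,4) IH(2) by (auto simp: less_Suc_eq)
  qed
  from * show "\<exists>c. supplemented (Unbarred l) (row (berele_P n (a @ v))) (row (berele_P n (a' @ v))) c" by blast
  from * show "i < length v \<Longrightarrow>
      square (lengths (row (berele_P n (a' @ take i v)))) (lengths (row (berele_P n (a' @ take (Suc i) v))))
        (lengths (row (berele_P n (a @ take i v)))) (lengths (row (berele_P n (a @ take (Suc i) v))))" by blast
qed

text \<open>The two equations between lengths in the second case describe the cell of the cancelling
  step: its top-right and bottom-left shapes agree, and the bottom-right one has a cell less in row
  \<open>k\<close>. They make \<open>backward_rule_blocked\<close> applicable.\<close>

lemma marked_run:
  assumes "set a \<subseteq> Gamma n" and "set a' \<subseteq> Gamma n" and "set v \<subseteq> Gamma n"
    and "\<forall>y \<in> set v. y < x" and "marked x (row (berele_P n a)) (row (berele_P n a')) c"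
  obtains (survives) c where "marked x (row (berele_P n (a @ v))) (row (berele_P n (a' @ v))) c"
  | (cancels) v1 y v2 k c where "v = v1 @ y # v2" "x = Barred (Suc k)"
      "lengths (row (berele_P n (a @ v1))) = lengths (row (berele_P n (a' @ v1 @ [y])))"
      "lengths (row (berele_P n (a @ v1))) =
         (lengths (row (berele_P n (a @ v1 @ [y]))))(k := Suc (length (row (berele_P n (a @ v1 @ [y])) k)))"
      "supplemented (Unbarred (Suc k)) (row (berele_P n (a @ v1 @ [y]))) (row (berele_P n (a' @ v1 @ [y]))) c"
proof -
  have "(\<exists>c. marked x (row (berele_P n (a @ v))) (row (berele_P n (a' @ v))) c) \<or>
    (\<exists>v1 y v2 k c. v = v1 @ y # v2 \<and> x = Barred (Suc k) \<and>
      lengths (row (berele_P n (a @ v1))) = lengths (row (berele_P n (a' @ v1 @ [y]))) \<and>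
      lengths (row (berele_P n (a @ v1))) =
         (lengths (row (berele_P n (a @ v1 @ [y]))))(k := Suc (length (row (berele_P n (a @ v1 @ [y])) k))) \<and>
      supplemented (Unbarred (Suc k)) (row (berele_P n (a @ v1 @ [y]))) (row (berele_P n (a' @ v1 @ [y]))) c)"
    using assms(3,4)
  proof (induction v rule: rev_induct)
    case Nil
    then show ?case using assms(5) by auto
  next
    case (snoc y v)
    then have y: "y \<in> Gamma n" "y < x" by auto
    have "set v \<subseteq> Gamma n" "\<forall>y \<in> set v. y < x" using snoc.prems by auto
    from snoc.IH[OF this] consider
      (1) c where "marked x (row (berele_P n (a @ v))) (row (berele_P n (a' @ v))) c"
    | (2) v1 z v2 k c where "v = v1 @ z # v2" "x = Barred (Suc k)"
      "lengths (row (berele_P n (a @ v1))) = lengths (row (berele_P n (a' @ v1 @ [z])))"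
      "lengths (row (berele_P n (a @ v1))) =
         (lengths (row (berele_P n (a @ v1 @ [z]))))(k := Suc (length (row (berele_P n (a @ v1 @ [z])) k)))"
      "supplemented (Unbarred (Suc k)) (row (berele_P n (a @ v1 @ [z]))) (row (berele_P n (a' @ v1 @ [z]))) c"
      by blast
    then show ?case
    proof cases
      case 1
      from marked_step[OF 1 y(2) Gamma_ge[OF y(1)]] obtain Q Q' where
        Q: "berele_step y (row (berele_P n (a @ v))) Q" "berele_step y (row (berele_P n (a' @ v))) Q'"
        and alt: "(\<exists>c'. marked x Q Q' c') \<or>
          (\<exists>k. x = Barred (Suc k) \<and> lengths (row (berele_P n (a @ v))) = lengths Q' \<and>
            lengths (row (berele_P n (a @ v))) = (lengths Q)(k := Suc (length (Q k))) \<and>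
            Q' = Q(k := Q k @ [Unbarred (Suc k)]) \<and> symplectic Q \<and> symplectic Q' \<and> (\<forall>a \<in> letters Q'. a < x))"
        by blast
      have r: "row (berele_P n (a @ v @ [y])) = Q" "row (berele_P n (a' @ v @ [y])) = Q'"
        using row_berele_P_snoc[OF _ y(1) Q(1)] row_berele_P_snoc[OF _ y(1) Q(2)] assms(1,2) snoc.prems(1)
        by auto
      from alt show ?thesis
      proof
        assume "\<exists>c'. marked x Q Q' c'"
        then show ?thesis using r by blast
      next
        assume "\<exists>k. x = Barred (Suc k) \<and> lengths (row (berele_P n (a @ v))) = lengths Q' \<and>
            lengths (row (berele_P n (a @ v))) = (lengths Q)(k := Suc (length (Q k))) \<and>
            Q' = Q(k := Q k @ [Unbarred (Suc k)]) \<and> symplectic Q \<and> symplectic Q' \<and> (\<forall>a \<in> letters Q'. a < x)"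
        then obtain k where k: "x = Barred (Suc k)" "lengths (row (berele_P n (a @ v))) = lengths Q'"
            "lengths (row (berele_P n (a @ v))) = (lengths Q)(k := Suc (length (Q k)))"
            "Q' = Q(k := Q k @ [Unbarred (Suc k)])" "symplectic Q" "symplectic Q'" "\<forall>a \<in> letters Q'. a < x"
          by blast
        have "supplemented (Unbarred (Suc k)) Q Q' k"
          using k(1,7) by (intro supplemented_start k(4-6)) simp
        then show ?thesis
          using k(1-3) r by (intro disjI2 exI[of _ v] exI[of _ y] exI[of _ "[]"] exI[of _ k]) (auto simp del: fun_upd_apply)
      qed
    next
      case 2
      then have "v @ [y] = v1 @ z # (v2 @ [y])" by simp
      then show ?thesis using 2(2-5) by blast
    qed
  qed
  then show thesis using that by blast
qed

section \<open>The two comparisons as operations on tableaux\<close>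

lemma delete_rightmost_marked:
  assumes T: "sp_tableau n T" and T': "sp_tableau n T'" and m: "marked x (row T) (row T') c"
  shows "delete_rightmost x T = T'"
proof -
  from m obtain S \<nu> where lt: "\<forall>a \<in> letters S. a < x"
    and st: "strip x S \<nu>" and st1: "strip x S (\<nu>(c := Suc (\<nu> c)))"
    and top: "\<forall>i < c. \<nu> i = length (S i)"
    and R: "row T = fill x S (\<nu>(c := Suc (\<nu> c)))" and R': "row T' = fill x S \<nu>"
    unfolding marked_def by blast
  let ?\<nu>1 = "\<nu>(c := Suc (\<nu> c))"
  have p: "proper T" "proper T'" using T T' by (auto simp: sp_tableau_row)
  have len: "length (row T i) = ?\<nu>1 i" for i unfolding R length_fill[OF st1] by simp
  have S_lt: "S i ! j < x" if "j < length (S i)" for i j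
    using lt nth_mem[OF that] by (auto simp: letters_def)
  have x: "in_shape T i j \<and> T ! i ! j = x \<longleftrightarrow> length (S i) \<le> j \<and> j < ?\<nu>1 i" for i j
  proof (cases "j < ?\<nu>1 i")
    case True
    then have "i < length T" using len[of i] by (auto simp: row_def split: if_splits)
    then have "T ! i ! j = row T i ! j" by (simp add: row_def)
    also have "\<dots> = (if j < length (S i) then S i ! j else x)"
      using True unfolding R by (auto simp: fill_def nth_append)
    finally show ?thesis using True S_lt[of j i] by (auto simp: in_shape_row len)
  qed (simp add: in_shape_row len)
  have lenS: "length (S j) \<le> length (S i)" if "i \<le> j" for i j
  proof -
    have "length (S (Suc i)) \<le> length (S i)" for i using st unfolding strip_def by (meson le_trans)
    then show ?thesis using that by (rule lift_Suc_antimono_le)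
  qed
  have below: "?\<nu>1 i \<le> \<nu> c" if "c < i" for i
  proof -
    obtain j where j: "i = Suc j" "c \<le> j" using \<open>c < i\<close> by (cases i) auto
    have "?\<nu>1 i \<le> length (S j)" using st1 j unfolding strip_def by blast
    also have "\<dots> \<le> length (S c)" using lenS j by blast
    also have "\<dots> \<le> \<nu> c" using st unfolding strip_def by blast
    finally show ?thesis .
  qed
  have cx: "length (S c) \<le> \<nu> c \<and> \<nu> c < ?\<nu>1 c" using st by (simp add: strip_def)
  \<comment> \<open>Rows above \<open>c\<close> contain no \<open>x\<close> and rows below
    \<open>c\<close> end before column \<open>\<nu> c\<close>, so the rightmost \<open>x\<close> is
    the last letter of row \<open>c\<close>.\<close>
  have bound: "i = c \<and> j = \<nu> c \<or> j < \<nu> c" if "length (S i) \<le> j \<and> j < ?\<nu>1 i" for i j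
    using that top below[of i] by (cases i c rule: linorder_cases) (auto split: if_splits)
  have "Max {j. \<exists>i. in_shape T i j \<and> T ! i ! j = x} = \<nu> c"
  proof (rule Max_eqI)
    show "finite {j. \<exists>i. in_shape T i j \<and> T ! i ! j = x}"
      by (rule finite_subset[of _ "{..\<nu> c}"]) (auto simp: x dest!: bound simp del: fun_upd_apply)
    show "j \<le> \<nu> c" if "j \<in> {j. \<exists>i. in_shape T i j \<and> T ! i ! j = x}" for j
      using that unfolding x by (auto dest!: bound simp del: fun_upd_apply)
    show "\<nu> c \<in> {j. \<exists>i. in_shape T i j \<and> T ! i ! j = x}" unfolding x using cx by blast
  qed
  moreover have "(THE i. in_shape T i (\<nu> c) \<and> T ! i ! \<nu> c = x) = c"
    unfolding x using cx bound by (intro the_equality) blast+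
  ultimately have d: "delete_rightmost x T = remove_cell c (\<nu> c) T"
    by (simp add: delete_rightmost_def)
  have c: "c < length T" using len[of c] by (auto simp: row_def split: if_splits)
  have rc: "T ! c = row T c" using c by (simp add: row_def)
  let ?r = "take (\<nu> c) (row T c)"
  have "d = filter (\<lambda>r. r \<noteq> []) (T[c := ?r])" if "d = remove_cell c (\<nu> c) T" for d
    using that len[of c] by (simp add: remove_cell_def rc)
  note d = this[OF d]
  have "?r \<noteq> [] \<or> Suc c = length T"
  proof (cases "\<nu> c = 0")
    case True
    then have "row T (Suc c) = []" using len[of "Suc c"] below[of "Suc c"] by simp
    then have "\<not> Suc c < length T" using proper_row_iff[OF p(1)] by blast
    then show ?thesis using c by simp
  next
    case False
    then show ?thesis using len[of c] by auto
  qed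
  note f = row_filter_update[OF p(1) c this]
  have "(row T)(c := ?r) = row T'"
    unfolding R R' using st by (auto simp: fill_def strip_def fun_eq_iff)
  then show ?thesis using f p(2) proper_row_inject unfolding d by metis
qed

text \<open>Column \<open>\<nu> c\<close> meets letters of the core above row \<open>c\<close> and
  is empty from there on. It thus avoids \<open>x\<close> and has height \<open>c\<close>.\<close>

lemma add_to_column_supplemented:
  assumes T: "sp_tableau n T" and T': "sp_tableau n T'" and m: "supplemented x (row T) (row T') c"
  shows "add_to_column x T = T'"
proof -
  from m obtain S \<nu> where lt: "\<forall>a \<in> letters S. a < x"
    and st: "strip x S \<nu>" and st1: "strip x S (\<nu>(c := Suc (\<nu> c)))"
    and bot: "\<forall>i \<ge> c. \<nu> (Suc i) = length (S i)"
    and R: "row T = fill x S \<nu>" and R': "row T' = fill x S (\<nu>(c := Suc (\<nu> c)))"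
    unfolding supplemented_def by blast
  have p: "proper T" "proper T'" using T T' by (auto simp: sp_tableau_row)
  have len: "length (row T i) = \<nu> i" for i unfolding R length_fill[OF st] by simp
  have S_lt: "S i ! j < x" if "j < length (S i)" for i j
    using lt nth_mem[OF that] by (auto simp: letters_def)
  have x: "in_shape T i j \<and> T ! i ! j = x \<longleftrightarrow> length (S i) \<le> j \<and> j < \<nu> i" for i j
  proof (cases "j < \<nu> i")
    case True
    then have "i < length T" using len[of i] by (auto simp: row_def split: if_splits)
    then have "T ! i ! j = row T i ! j" by (simp add: row_def)
    also have "\<dots> = (if j < length (S i) then S i ! j else x)"
      using True unfolding R by (auto simp: fill_def nth_append)
    finally show ?thesis using True S_lt[of j i] by (auto simp: in_shape_row len)
  qed (simp add: in_shape_row len)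
  have lenS: "length (S j) \<le> length (S i)" if "i \<le> j" for i j
  proof -
    have "length (S (Suc i)) \<le> length (S i)" for i using st unfolding strip_def by (meson le_trans)
    then show ?thesis using that by (rule lift_Suc_antimono_le)
  qed
  have above: "\<nu> c < length (S i)" if "i < c" for i
  proof -
    obtain j where j: "c = Suc j" "i \<le> j" using \<open>i < c\<close> by (cases c) auto
    have "Suc (\<nu> c) \<le> length (S j)" using st1 j unfolding strip_def by (metis fun_upd_same)
    also have "\<dots> \<le> length (S i)" using lenS j by blast
    finally show ?thesis by simp
  qed
  have below: "\<nu> i \<le> \<nu> c" if "c \<le> i" for i
  proof -
    have "\<nu> (Suc i) \<le> \<nu> i" for i using st unfolding strip_def by (meson le_trans)
    then show ?thesis using that by (rule lift_Suc_antimono_le)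
  qed
  have col: "(LEAST j. \<nexists>i. in_shape T i j \<and> T ! i ! j = x) = \<nu> c"
    unfolding x
  proof (rule Least_equality)
    show "\<nexists>i. length (S i) \<le> \<nu> c \<and> \<nu> c < \<nu> i" using above below by (meson leD not_less)
    show "\<nu> c \<le> j" if "\<nexists>i. length (S i) \<le> j \<and> j < \<nu> i" for j
    proof (rule ccontr)
      assume "\<not> \<nu> c \<le> j"
      \<comment> \<open>A column further left without \<open>x\<close> would never end: in each row
        from \<open>c\<close> on its cell belongs to the core, and there the next row is as long as
        the core.\<close>
      have "j < \<nu> (c + i)" for i
      proof (induction i)
        case 0
        then show ?case using \<open>\<not> \<nu> c \<le> j\<close> by simp
      next
        case (Suc i)
        then have "j < length (S (c + i))" using that by (meson not_le)
        then show ?case using bot by simp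
      qed
      then have "j < \<nu> (c + length T)" .
      then show False using len[of "c + length T"] by (simp add: row_def)
    qed
  qed
  have "\<nu> c < \<nu> i" if "i < c" for i
    using above[OF that] st unfolding strip_def by (meson less_le_trans)
  then have "{i. in_shape T i (\<nu> c)} = {..<c}"
    unfolding in_shape_row len using below by (auto simp flip: not_le)
  then have h: "card {i. in_shape T i (\<nu> c)} = c" by simp
  have R'': "row T' = (row T)(c := row T c @ [x])"
  proof -
    have "length (S c) \<le> \<nu> c" using st unfolding strip_def by blast
    then show ?thesis unfolding R R' by (rule fill_append_cell)
  qed
  show ?thesis
  proof (cases "c < length T")
    case True
    then have T1: "add_to_column x T = T[c := row T c @ [x]]"
      unfolding add_to_column_def Let_def col h by (simp add: row_def)
    have "row (T[c := row T c @ [x]]) = row T'" unfolding R'' using row_update[OF True] .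
    moreover have "proper (T[c := row T c @ [x]])" using p(1) by (rule proper_update) simp
    ultimately show ?thesis unfolding T1 using p(2) proper_row_inject by blast
  next
    case False
    then have T1: "add_to_column x T = T @ [[x]]"
      unfolding add_to_column_def Let_def col h by simp
    have "c = length T"
    proof (rule ccontr)
      assume "c \<noteq> length T"
      then have "length T < c" using False by simp
      from above[OF this] have "0 < \<nu> (length T)" using st unfolding strip_def by (metis gr0I le_zero_eq not_less_zero)
      then show False using len[of "length T"] by (simp add: row_def)
    qed
    then have "row (T @ [[x]]) = row T'"
      unfolding R'' by (auto simp: row_def nth_append fun_eq_iff)
    moreover have "proper (T @ [[x]])" using p(1) by (simp add: proper_def)
    ultimately show ?thesis unfolding T1 using p(2) proper_row_inject by blast
  qed
qed

section \<open>Bounds and initial data for the final comparison\<close>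

lemma symplectic_row_empty:
  assumes "symplectic R" and "\<forall>a \<in> letters R. a \<le> x" and "num x \<le> i"
  shows "R i = []"
proof (rule ccontr)
  assume "R i \<noteq> []"
  then have "hd (R i) \<in> set (R i)" by simp
  then have "Unbarred (Suc i) \<le> hd (R i)" "hd (R i) \<le> x"
    using assms(1,2) by (auto simp: symplectic_def letters_def)
  then have "Unbarred (Suc i) \<le> x" by simp
  then show False using assms(3) by (cases x) (auto simp: less_eq_letter_def)
qed

lemma finite_letters_row: "finite (letters (row T))"
  by (simp add: entries_row[symmetric] entries_def)

lemma num_mono: "x \<le> y \<Longrightarrow> num x \<le> num y"
  by (cases x; cases y) (auto simp: less_eq_letter_def)

lemma supplemented_letters:
  "supplemented x R R' c \<Longrightarrow> \<forall>a \<in> letters R \<union> letters R'. a \<le> x"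
  unfolding supplemented_def using letters_fill[of x] by (fastforce dest: less_imp_le)

lemma marked_mem:
  assumes "marked x R R' c"
  shows "x \<in> letters R"
proof -
  from assms obtain S \<nu> where st: "strip x S \<nu>" and R: "R = fill x S (\<nu>(c := Suc (\<nu> c)))"
    unfolding marked_def by blast
  have "length (S c) \<le> \<nu> c" using st unfolding strip_def by blast
  then have "x \<in> set (R c)" unfolding R by (simp add: fill_def)
  then show ?thesis by (auto simp: letters_def)
qed

lemma marked_length: "marked x R R' c \<Longrightarrow> length (R c) = Suc (length (R' c))"
  unfolding marked_def using length_fill by fastforce

lemma supplemented_length: "supplemented x R R' c \<Longrightarrow> length (R i) \<le> length (R' i)"
  unfolding supplemented_def using length_fill by fastforce

text \<open>Starting point of the comparison of \<open>w\<close> with the word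
  \<open>l w\<close>.\<close>

lemma supplemented_singleton:
  assumes "1 \<le> l"
  shows "supplemented (Unbarred l) (\<lambda>_. []) ((\<lambda>_. [])(0 := [Unbarred l])) 0"
proof -
  let ?S = "(\<lambda>_. []) :: filling"
  have "symplectic ?S" by (simp add: symplectic_def)
  moreover have "\<forall>a \<in> letters ?S. a < Unbarred l" by (simp add: letters_def)
  moreover have "strip (Unbarred l) ?S (\<lambda>_. 0)" by (simp add: strip_def)
  moreover have "strip (Unbarred l) ?S ((\<lambda>_. 0)(0 := Suc 0))"
    using assms by (simp add: strip_def less_eq_letter_def)
  ultimately have "supplemented (Unbarred l) (fill (Unbarred l) ?S (\<lambda>_. 0))
      (fill (Unbarred l) ?S ((\<lambda>_. 0)(0 := Suc 0))) 0"
    by (intro supplementedI) auto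
  moreover have "fill (Unbarred l) ?S (\<lambda>_. 0) = ?S"
    and "fill (Unbarred l) ?S ((\<lambda>_. 0)(0 := Suc 0)) = ?S(0 := [Unbarred l])"
    by (auto simp: fill_def fun_eq_iff)
  ultimately show ?thesis by simp
qed

lemma berele_P_singleton: "x \<in> Gamma n \<Longrightarrow> row (berele_P n [x]) = (\<lambda>_. [])(0 := [x])"
  using row_berele_P_snoc[of "[]" n x "(\<lambda>_. [])(0 := [x])"]
    berele_step_max[of "\<lambda>_. []" x] Gamma_ge[of x n]
  by (simp add: berele_P_def symplectic_def letters_def fun_upd_def row_def[abs_def])

lemma is_partition_shape_P: "set w \<subseteq> Gamma n \<Longrightarrow> is_partition (shape (berele_P n w))"
  using sp_tableau_berele_P by (auto simp: sp_tableau_def)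

text \<open>A surviving mark proves the first four claims and refutes the hypothesis of (5). A
  cancellation satisfies the hypotheses common to (4) and (5), proves the conclusion of (5) and
  refutes the hypothesis of (4). Hence each outcome of the test only has to be excluded in the wrong
  alternative.\<close>

theorem theorem4p2:
  fixes n f l m :: nat and w :: "letter list" and P P' Pbar :: tableau
    and \<kappa> :: "partition list" and \<gamma> :: letter
  assumes "set w \<subseteq> Gamma n" and "length w = f" and "f \<ge> 1"
    and "P = berele_P n w" and "\<kappa> = berele_Q n w"
    and "P' = berele_P n (delete_rightmost_word (Max (set w)) w)"
    and "l = Max ((\<lambda>j. length (\<kappa> ! j)) ` {0..f})"
    and "\<gamma> = Max (entries P)" and "m = (if P = [] then 0 else num \<gamma>)"
    and "Pbar = add_to_column (Unbarred l) P"
  shows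
    "(m > l \<longrightarrow> Max (set w) = \<gamma> \<and> P' = delete_rightmost \<gamma> P) \<and>
     (m \<le> l \<longrightarrow>
       (Barred l \<in> entries P \<longrightarrow>
          Max (set w) = Barred l \<and> P' = delete_rightmost (Barred l) P) \<and>
       (Barred l \<notin> entries P \<and> \<not> (\<exists>j\<in>{1..f}. covered l (\<kappa> ! j) (\<kappa> ! (j - 1))) \<longrightarrow>
          Max (set w) = Unbarred l \<and> P \<noteq> [] \<and> \<gamma> = Unbarred l \<and>
          P' = delete_rightmost (Unbarred l) P) \<and>
       (Barred l \<notin> entries P \<and> (\<exists>j\<in>{1..f}. covered l (\<kappa> ! j) (\<kappa> ! (j - 1))) \<longrightarrow>
          (test_reaches_left_edge \<kappa> (Barred l) f (shape Pbar) \<longrightarrow>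
             P' \<noteq> Pbar \<and> Max (set w) = Unbarred l \<and> P \<noteq> [] \<and> \<gamma> = Unbarred l \<and>
             P' = delete_rightmost (Unbarred l) P) \<and>
          (test_encounters RuleO \<kappa> (Barred l) f (shape Pbar) \<longrightarrow>
             P' = Pbar \<and> Max (set w) = Barred l)))"
proof -
  define x where "x = Max (set w)"
  have w: "set w \<subseteq> Gamma n" and f: "length w = f" by (fact assms)+
  have ne: "w \<noteq> []" using assms(2,3) by auto
  have xw: "x \<in> set w" and xmax: "\<forall>y \<in> set w. y \<le> x"
    using ne by (simp_all add: x_def)
  then have x\<Gamma>: "x \<in> Gamma n" using w by blast
  have w_take: "set (take j w) \<subseteq> Gamma n" for j using w set_take_subset[of j w] by blast
  obtain u v where uv: "w = u @ x # v" and xv: "x \<notin> set v"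
    using split_list_last[OF xw] by blast
  have sets: "set u \<subseteq> Gamma n" "set (u @ [x]) \<subseteq> Gamma n" "set v \<subseteq> Gamma n"
    "\<forall>y \<in> set v. y < x" "\<forall>y \<in> set u. y \<le> x"
    using w xmax xv unfolding uv by (auto simp: order_le_less)
  have "delete_rightmost_word x w = u @ v"
    using xv by (simp add: uv delete_rightmost_word_def remove1_append)
  then have P': "P' = berele_P n (u @ v)" using assms(6) by (simp add: x_def)
  have P: "P = berele_P n ((u @ [x]) @ v)" using assms(4) by (simp add: uv)
  have spP: "sp_tableau n P" and spP': "sp_tableau n P'"
    unfolding P P' by (rule sp_tableau_berele_P, use w uv in auto)+
  have \<kappa>: "\<kappa> ! j = shape (berele_P n (take j w))" if "j \<le> f" for j
    using that f by (simp add: assms(5) berele_Q_def nth_append del: upt_Suc)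
  have \<kappa>_part: "part (\<kappa> ! j) = lengths (row (berele_P n (take j w)))" if "j \<le> f" for j
    using \<kappa>[OF that] by (simp add: part_shape)
  have \<kappa>_partition: "is_partition (\<kappa> ! j)" if "j \<le> f" for j
    using \<kappa>[OF that] is_partition_shape_P[OF w_take] by simp
  have len_le: "length (\<kappa> ! j) \<le> l" if "j \<le> f" for j
    using that unfolding assms(7) by (intro Max_ge) auto
  have le_x: "\<forall>a \<in> letters (row (berele_P n (take j w))). a \<le> x" for j
    using letters_berele_P[OF w_take, of j] xmax set_take_subset[of j w] by blast
  have "length (\<kappa> ! j) \<le> num x" if "j \<le> f" for j
  proof (rule ccontr)
    assume "\<not> ?thesis"
    then have "0 < part (\<kappa> ! j) (num x)" using part_pos_iff \<kappa>_partition[OF that] by auto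
    moreover have "symplectic (row (berele_P n (take j w)))"
      using sp_tableau_berele_P[OF w_take] by (simp add: sp_tableau_row)
    ultimately show False
      using symplectic_row_empty[OF _ le_x[of j]] by (simp add: \<kappa>_part[OF that])
  qed
  then have l_le: "l \<le> num x" unfolding assms(7) by (intro Max.boundedI) auto
  \<comment> \<open>The first insertion always creates a cell, so \<open>l\<close> is positive and
    \<open>Unbarred l\<close> is admissible in the first row.\<close>
  have "\<kappa> ! 1 \<noteq> []"
  proof
    assume "\<kappa> ! 1 = []"
    moreover have "take 1 w = [hd w]" using ne by (cases w) auto
    moreover have "hd w \<in> Gamma n" using ne w by auto
    ultimately show False
      using \<kappa>_part[of 1] berele_P_singleton[of "hd w" n] assms(3)
      by (auto simp: part_def fun_eq_iff dest: spec[of _ 0])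
  qed
  then have l1: "1 \<le> l" using len_le[of 1] assms(3) by (cases "\<kappa> ! 1") auto
  have P_full: "P = berele_P n (take f w)" using f assms(4) by simp
  have P_le: "\<forall>a \<in> letters (row P). a \<le> x" using le_x[of f] by (simp add: P_full)

  note start = marked_start[OF sets(2,5)]
  show ?thesis
  proof (cases rule: marked_run[OF sets(2,1,3,4) start, case_names survives cancels])
    case (survives c)
    then have mk: "marked x (row P) (row P') c" by (simp add: P P')
    have xP: "x \<in> entries P" using marked_mem[OF mk] by (simp add: entries_row)
    have \<gamma>: "\<gamma> = x"
      unfolding assms(8) using xP P_le finite_letters_row by (intro Max_eqI) (auto simp: entries_row)
    have Pne: "P \<noteq> []" using xP by (auto simp: entries_def)
    have m: "m = num x" using assms(9) Pne \<gamma> by simp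
    have del: "P' = delete_rightmost x P" using delete_rightmost_marked[OF spP spP' mk] by simp
    have Barred: "Barred l \<in> entries P \<Longrightarrow> x = Barred l" if "m \<le> l"
    proof -
      assume "Barred l \<in> entries P"
      then have "Barred l \<le> x" using P_le by (simp add: entries_row)
      moreover have "num x = l" using that l_le m by simp
      ultimately show "x = Barred l" by (cases x) (auto simp: less_eq_letter_def)
    qed
    have Unbarred: "x = Unbarred l" if "m \<le> l" "Barred l \<notin> entries P"
    proof -
      have "num x = l" using that l_le m by simp
      moreover have "x \<noteq> Barred l" using that(2) xP by auto
      ultimately show ?thesis by (cases x) auto
    qed
    have test: "P' \<noteq> Pbar \<and> \<not> test_encounters RuleO \<kappa> (Barred l) f (shape Pbar)"
      if x: "x = Unbarred l"
    proof -
      \<comment> \<open>The word of \<open>\<sigma> j\<close> has one letter more than that of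
        \<open>\<kappa> ! j\<close>, so the retraced shapes extend down to position 0.\<close>
      define \<sigma> where "\<sigma> j = shape (berele_P n ([x] @ take j w))" for j
      have set_x: "set ([x] @ take j w) \<subseteq> Gamma n" for j using x\<Gamma> w_take by simp
      have le_l: "\<forall>y \<in> set (take j w). y \<le> Unbarred l" for j
        using xmax set_take_subset[of j w] x by blast
      have r0: "row (berele_P n []) = (\<lambda>_. [])" by (simp add: berele_P_def row_def[abs_def])
      have start: "supplemented (Unbarred l) (row (berele_P n [])) (row (berele_P n [x])) 0"
        unfolding berele_P_singleton[OF x\<Gamma>] r0 unfolding x by (rule supplemented_singleton[OF l1])
      have run: "\<exists>c. supplemented (Unbarred l) (row (berele_P n (take j w))) (row (berele_P n ([x] @ take j w))) c" for j
        using supplemented_run(1)[OF _ _ w_take le_l start, of j] x\<Gamma> by simp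
      have sq: "square (part (\<sigma> j)) (part (\<sigma> (Suc j))) (part (\<kappa> ! j)) (part (\<kappa> ! Suc j))" if "j < f" for j
        using supplemented_run(2)[OF _ _ w _ start, of j] x\<Gamma> that f xmax x
        by (simp add: \<sigma>_def part_shape \<kappa>_part)
      have p: "is_partition (\<sigma> j) \<and> is_partition (\<kappa> ! j) \<and> (\<forall>i \<ge> l. part (\<sigma> j) i = 0)" if "j \<le> f" for j
      proof -
        from run obtain c where "supplemented (Unbarred l) (row (berele_P n (take j w))) (row (berele_P n ([x] @ take j w))) c" by blast
        then have "\<forall>a \<in> letters (row (berele_P n ([x] @ take j w))). a \<le> Unbarred l"
          using supplemented_letters by blast
        then have "\<forall>i \<ge> l. part (\<sigma> j) i = 0"
          using symplectic_row_empty sp_tableau_berele_P[OF set_x] by (simp add: \<sigma>_def part_shape sp_tableau_row)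
        then show ?thesis
          using is_partition_shape_P[OF set_x] \<kappa>_partition that by (simp add: \<sigma>_def)
      qed
      obtain c' where c': "supplemented (Unbarred l) (row P) (row (berele_P n ([x] @ w))) c'"
        using run[of f] f by (auto simp: P_full)
      have Pbar: "Pbar = berele_P n ([x] @ w)"
        unfolding assms(10) using add_to_column_supplemented[OF spP _ c'] sp_tableau_berele_P[OF set_x[of f]] f
        by simp
      then have \<sigma>f: "shape Pbar = \<sigma> f" using f by (simp add: \<sigma>_def)
      \<comment> \<open>\<open>P'\<close> is shorter than \<open>P\<close> in row \<open>c\<close>,
        whereas \<open>Pbar\<close> is nowhere shorter than \<open>P\<close>.\<close>
      have "length (row P' c) < length (row Pbar c)"
        using marked_length[OF mk] supplemented_length[OF c', of c] unfolding Pbar by simp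
      then have "P' \<noteq> Pbar" by auto
      moreover have "\<not> test_encounters RuleO \<kappa> (Barred l) f (shape Pbar)"
      proof
        assume "test_encounters RuleO \<kappa> (Barred l) f (shape Pbar)"
        then obtain j \<tau> A where bt: "backward_test \<kappa> (Barred l) f (\<sigma> f) j \<tau>" and j: "1 \<le> j"
          and br: "backward_rule (Barred l) \<tau> (\<kappa> ! (j - 1)) (\<kappa> ! j) RuleO A"
          unfolding test_encounters_def \<sigma>f by blast
        have "j \<le> f \<and> \<tau> = \<sigma> j"
          using backward_test_unique[where q = 0, OF _ sq p _ bt] by auto
        moreover obtain i where "j = Suc i" using j by (cases j) auto
        ultimately show False
          using backward_rule_square[OF sq[of i], of l RuleO A] p[of i] p[of j] br by auto
      qed
      ultimately show ?thesis by blast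
    qed
    show ?thesis
      unfolding x_def[symmetric] using \<gamma> del Barred Unbarred test Pne by blast
  next
    case (cancels v1 y v2 k c)
    note v = cancels(1) and x = cancels(2) and len1 = cancels(3) and len2 = cancels(4) and sup = cancels(5)
    \<comment> \<open>The cancelling step leads from position \<open>q - 1\<close> of
      \<open>w\<close> to position \<open>q\<close>. Since the shortened word lacks an earlier
      \<open>x\<close>, \<open>\<sigma> j\<close> belongs to a prefix with \<open>j - 1\<close>
      letters.\<close>
    define q where "q = Suc (Suc (length u + length v1))"
    define \<sigma> where "\<sigma> j = shape (berele_P n ((u @ v1 @ [y]) @ take (j - q) v2))" for j
    have q: "q \<le> f" "0 < q" using f by (auto simp: q_def uv v)
    have w_split: "w = ((u @ [x]) @ v1 @ [y]) @ v2" by (simp add: uv v)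
    have take_q: "take j w = ((u @ [x]) @ v1 @ [y]) @ take (j - q) v2" if "q \<le> j" for j
    proof -
      have "length ((u @ [x]) @ v1 @ [y]) = q" by (simp add: q_def)
      then show ?thesis using that unfolding w_split by (metis take_append take_all)
    qed
    have take_q1: "take (q - 1) w = (u @ [x]) @ v1"
      unfolding w_split by (simp add: q_def)
    have sv: "set (u @ v1 @ [y]) \<subseteq> Gamma n" "set ((u @ [x]) @ v1 @ [y]) \<subseteq> Gamma n" "set v2 \<subseteq> Gamma n"
      using w by (auto simp: w_split)
    have set_\<sigma>: "set ((u @ v1 @ [y]) @ take i v2) \<subseteq> Gamma n" for i
      using sv(1,3) set_take_subset[of i v2] by auto
    \<comment> \<open>The cancelled letter occupied row \<open>num x\<close>, counted from 1, so
      this many rows did occur; together with \<open>l_le\<close> this fixes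
      \<open>l\<close>.\<close>
    have "part (\<kappa> ! (q - 1)) k \<noteq> 0"
      using q fun_cong[OF len2, of k] take_q1 by (simp add: \<kappa>_part)
    then have "k < length (\<kappa> ! (q - 1))" by (auto simp: part_def split: if_splits)
    then have "Suc k \<le> l" using len_le[of "q - 1"] q by linarith
    then have l: "l = Suc k" using l_le x by simp
    have xl: "x = Barred l" using x l by simp
    have v2: "\<forall>y \<in> set v2. y \<le> Unbarred l"
      using sets(4) unfolding v xl by (auto simp: less_letter_def less_eq_letter_def less_Suc_eq_le ball_Un)
    have v2': "\<forall>y \<in> set (take i v2). y \<le> Unbarred l" "set (take i v2) \<subseteq> Gamma n" for i
      using v2 sv(3) set_take_subset[of i v2] by blast+
    note sup = sup[folded l, simplified]
    have run: "\<exists>c. supplemented (Unbarred l) (row (berele_P n (((u @ [x]) @ v1 @ [y]) @ take i v2)))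
        (row (berele_P n ((u @ v1 @ [y]) @ take i v2))) c" for i
      using supplemented_run(1)[OF sv(2,1) v2'(2,1), of c i] sup by simp
    have sq: "square (part (\<sigma> j)) (part (\<sigma> (Suc j))) (part (\<kappa> ! j)) (part (\<kappa> ! Suc j))"
      if "q \<le> j" "j < f" for j
    proof -
      have "j - q < length v2" using that f unfolding w_split q_def by simp
      from supplemented_run(2)[OF sv(2,1,3) v2, of c, OF _ this] sup that show ?thesis
        by (simp add: \<sigma>_def part_shape \<kappa>_part take_q Suc_diff_le)
    qed
    have p: "is_partition (\<sigma> j) \<and> is_partition (\<kappa> ! j) \<and> (\<forall>i \<ge> l. part (\<sigma> j) i = 0)"
      if "q \<le> j" "j \<le> f" for j
    proof -
      have "\<forall>a \<in> letters (row (berele_P n ((u @ v1 @ [y]) @ take (j - q) v2))). a \<le> Unbarred l"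
        using run[of "j - q"] supplemented_letters by blast
      then have "\<forall>i \<ge> l. part (\<sigma> j) i = 0"
        using symplectic_row_empty sp_tableau_berele_P[OF set_\<sigma>] by (simp add: \<sigma>_def part_shape sp_tableau_row)
      then show ?thesis
        using is_partition_shape_P[OF set_\<sigma>] \<kappa>_partition that by (simp add: \<sigma>_def)
    qed
    obtain c' where c': "supplemented (Unbarred l) (row P) (row P') c'"
      using run[of "length v2"] by (auto simp: P P' v)
    have P'bar: "P' = Pbar"
      unfolding assms(10) using add_to_column_supplemented[OF spP spP' c'] by simp
    have \<sigma>f: "shape Pbar = \<sigma> f"
    proof -
      have "f - q = length v2" unfolding f[symmetric] w_split q_def by simp
      then show ?thesis unfolding P'bar[symmetric] by (simp add: \<sigma>_def P' v)
    qed
    have P_le: "\<forall>a \<in> letters (row P). a \<le> Unbarred l" using supplemented_letters[OF c'] by blast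
    \<comment> \<open>Cancellations may leave \<open>P\<close> empty, and then \<open>m\<close> has
      the value 0.\<close>
    have ml: "m \<le> l"
    proof (cases "P = []")
      case False
      then obtain r where "r \<in> set P" "r \<noteq> []"
        using spP by (cases P) (auto simp: sp_tableau_row)
      then have "entries P \<noteq> {}" by (auto simp: entries_def)
      then have "\<gamma> \<in> entries P" unfolding assms(8) using finite_letters_row[of P]
        by (intro Max_in) (auto simp: entries_row)
      then have "\<gamma> \<le> Unbarred l" using P_le by (simp add: entries_row)
      then show ?thesis using num_mono assms(9) by fastforce
    qed (simp add: assms(9))
    have nB: "Barred l \<notin> entries P"
      using P_le by (auto simp: entries_row less_eq_letter_def)
    \<comment> \<open>At the cancelling step the shortened word gains the cell that only the full
      word had before, so it reaches the previous shape of the full word.\<close>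
    have Cq: "\<kappa> ! (q - 1) = \<sigma> q"
      using q len1 p[of q] \<kappa>_partition[of "q - 1"]
      by (intro part_inject) (simp_all add: \<kappa>_part take_q1[simplified] \<sigma>_def part_shape)
    have step_q: "part (\<kappa> ! (q - 1)) = (part (\<kappa> ! q))(l - 1 := Suc (part (\<kappa> ! q) (l - 1)))"
      using q len2 by (simp add: \<kappa>_part take_q1[simplified] take_q l)
    then have cov: "\<exists>j \<in> {1..f}. covered l (\<kappa> ! j) (\<kappa> ! (j - 1))"
      using q \<kappa>_partition l by (intro bexI[of _ q]) (auto simp: covered_iff)
    have blocked: "\<not> covered_some (\<kappa> ! (q - 1)) A"
      if "backward_rule (Barred l) (\<sigma> q) (\<kappa> ! (q - 1)) (\<kappa> ! q) r A" for r A
      using that backward_rule_blocked[OF _ _ _ step_q] \<kappa>_partition q l unfolding Cq[symmetric] by simp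
    have "\<not> test_reaches_left_edge \<kappa> (Barred l) f (shape Pbar)"
    proof
      assume "test_reaches_left_edge \<kappa> (Barred l) f (shape Pbar)"
      then obtain \<tau> where bt: "backward_test \<kappa> (Barred l) f (\<sigma> f) 0 \<tau>" "covered_some (\<kappa> ! 0) \<tau>"
        unfolding test_reaches_left_edge_def \<sigma>f by blast
      from backward_test_unique[OF q(1) sq p blocked bt(1)] bt(2) q(2) show False by auto
    qed
    then show ?thesis
      unfolding x_def[symmetric] using ml nB cov P'bar xl by auto
  qed
qed

end
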